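(* There exist an open neighborhood $\mathcal{A}\subset R$ of $p_0$ such that the set $\mathcal{X}$ of points $z_0\in\mathcal{A}$ whose $\mathbf{W}$-orbit is defined for all $k$ and satisfies $z_k\to p_0$ has the following properties: $\mathcal{X}$ is closed in $\mathcal{A}$, has Lebesgue measure zero, and is invariant under $\mathbf{W}$; for every $z_0=(x_0,y_0)\in\mathcal{X}$ with $y_0\ne0$ the convergence is quadratic, i.e. there are constants $c,C>0$ with $c|y_k|^2\le|y_{k+1}|\le C|y_k|^2$ for all $k$, where $z_k=(x_k,y_k)$; and $\mathcal{X}\cap\{y>0\}$ is homeomorphic to the Cartesian product of a Cantor set and an open interval.
   Context: For $x>0$, $y\in\mathbb{R}$ let $r_1^2=4+x^2+4x^2y^2$, $\Delta=((x+2)^2+8x^2y^2)((x-2)^2+8x^2y^2)$ and $\omega_\pm(x,y)=\frac{x^2-4\pm\sqrt{\Delta}}{2r_1^2}$. Let $p_0=(2,0)$, $R=\{(x,y): x>0,\ 4-4y^2-x^2y^2-8x^2y^4\ge 0\}$, $R_+=R\cap((0,2]\times\mathbb{R})$, $R_-=R\cap([2,\infty)\times\mathbb{R})$, and $r$ the line $x=2$. Define $\mathbf{W}_\pm(x,y)=\left(\frac{1+\omega_\pm}{1-\omega_\pm}x,\ \frac{|\omega_\pm|}{1+\omega_\pm}y\right)$ on $R_\pm$, and $\mathbf{W}$ on $R\setminus(r\setminus\{p_0\})$ by $\mathbf{W}=\mathbf{W}_+$ for $x<2$, $\mathbf{W}=\mathbf{W}_-$ for $x>2$, $\mathbf{W}(p_0)=p_0$.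 (This is Wilkinson's step in bidiagonal coordinates $(x,y)$ for $3\times3$ symmetric tridiagonal matrices with spectrum $\{-1,0,1\}$; $p_0$ corresponds to the matrix with rows $(0,1,0),(1,0,0),(0,0,0)$ and $|y|$ is comparable to the $(3,2)$ entry.) The $\mathbf{W}$-orbit of $z_0$ is $z_{k+1}=\mathbf{W}(z_k)$, defined as long as no $z_k$ lies on $r\setminus\{p_0\}$. *)

theory Defs
  imports "HOL-Analysis.Analysis"
begin

definition r1sq :: "real \<Rightarrow> real \<Rightarrow> real" where
  "r1sq x y = 4 + x^2 + 4 * x^2 * y^2"

definition Delta :: "real \<Rightarrow> real \<Rightarrow> real" where
  "Delta x y = ((x + 2)^2 + 8 * x^2 * y^2) * ((x - 2)^2 + 8 * x^2 * y^2)"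

definition omega_plus :: "real \<Rightarrow> real \<Rightarrow> real" where
  "omega_plus x y = (x^2 - 4 + sqrt (Delta x y)) / (2 * r1sq x y)"

definition omega_minus :: "real \<Rightarrow> real \<Rightarrow> real" where
  "omega_minus x y = (x^2 - 4 - sqrt (Delta x y)) / (2 * r1sq x y)"

definition p0 :: "real \<times> real" where
  "p0 = (2, 0)"

definition Rset :: "(real \<times> real) set" where
  "Rset = {(x, y). x > 0 \<and> 4 - 4 * y^2 - x^2 * y^2 - 8 * x^2 * y^4 \<ge> 0}"

definition W_of :: "real \<Rightarrow> real \<Rightarrow> real \<Rightarrow> real \<times> real" where
  "W_of w x y = ((1 + w) / (1 - w) * x, \<bar>w\<bar> / (1 + w) * y)"

definition W_plus :: "real \<times> real \<Rightarrow> real \<times> real" where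
  "W_plus z = (case z of (x, y) \<Rightarrow> W_of (omega_plus x y) x y)"

definition W_minus :: "real \<times> real \<Rightarrow> real \<times> real" where
  "W_minus z = (case z of (x, y) \<Rightarrow> W_of (omega_minus x y) x y)"

definition Wdom :: "(real \<times> real) set" where
  "Wdom = Rset - ({z. fst z = 2} - {p0})"

text \<open>Wilkinson's map (only meaningful on Wdom).\<close>
definition W :: "real \<times> real \<Rightarrow> real \<times> real" where
  "W z = (if fst z < 2 then W_plus z else if fst z > 2 then W_minus z else p0)"

definition orbit_defined :: "real \<times> real \<Rightarrow> bool" where
  "orbit_defined z0 \<longleftrightarrow> (\<forall>k. (W ^^ k) z0 \<in> Wdom)"

fun cantor_approx :: "nat \<Rightarrow> real set" where
  "cantor_approx 0 = {0..1}"
| "cantor_approx (Suc n) = (\<lambda>t. t / 3) ` cantor_approx n \<union> (\<lambda>t. t / 3 + 2 / 3) ` cantor_approx n"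

definition cantor_set :: "real set" where
  "cantor_set = (\<Inter>n. cantor_approx n)"

end

theory Submission
  imports Defs
begin

text \<open>Put \<open>x = 2 e\<^bsup>2a\<^esup>\<close>, \<open>y = h e\<^bsup>-a\<^esup> / sqrt 2\<close> and define \<open>b \<ge> 0\<close> by
  \<open>sinh\<^sup>2 b = sinh\<^sup>2 a + h\<^sup>2\<close>. Then \<open>\<omega>\<^sub>\<plusminus> = tanh (a \<plusminus> b)\<close>, and Wilkinson's step becomes
  \<open>(a, h) \<mapsto> (sgn a (2\<bar>a\<bar> - b), h sinh (b - \<bar>a\<bar>))\<close>. Near the origin it squares \<open>h\<close> while it moves \<open>a\<close>
  only by an amount comparable to \<open>h\<close>, so an orbit tends to the origin iff all its points lie
  in the sector \<open>\<bar>h\<bar>/3 \<le> \<bar>a\<bar> \<le> \<bar>h\<bar>\<close>: outside of it \<open>\<bar>a\<bar> - \<bar>h\<bar>\<close> becomes positive, and then it never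
  decreases. For \<open>h > 0\<close> the sector has two components, and the image of a curve that crosses one of them
  crosses both; hence every sequence of signs of \<open>a\<close> is realised at every height \<open>h\<close>. Nearly
  horizontal pairs of points with equal signs stay nearly horizontal and are not brought closer, so
  the signs and \<open>h\<close> determine the point, with a Lipschitz dependence when the signs are read as the
  digits \<open>0, 2\<close> of a ternary expansion. This gives at once the product structure and the null set.\<close>

section \<open>The step in hyperbolic coordinates\<close>

definition hyp :: "real \<Rightarrow> real \<Rightarrow> real" where
  "hyp a h = arsinh (sqrt ((sinh a)\<^sup>2 + h\<^sup>2))"

text \<open>The value on the line \<open>a = 0\<close> mirrors the convention \<open>W z = p0\<close> on the line \<open>x = 2\<close>.\<close>
definition G :: "real \<times> real \<Rightarrow> real \<times> real" where
  "G z = (case z of (a, h) \<Rightarrow>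
     if a = 0 then (0, 0) else (sgn a * (2 * \<bar>a\<bar> - hyp a h), h * sinh (hyp a h - \<bar>a\<bar>)))"

section \<open>Bounds for \<open>hyp\<close> and \<open>sinh\<close>\<close>

lemma sinh_hyp: "sinh (hyp a h) = sqrt ((sinh a)\<^sup>2 + h\<^sup>2)"
  by (simp add: hyp_def)

lemma sinh_hyp_sq: "(sinh (hyp a h))\<^sup>2 = (sinh a)\<^sup>2 + h\<^sup>2"
  by (simp add: sinh_hyp)

lemma hyp_zero: "hyp 0 0 = 0"
  by (simp add: hyp_def)

lemma sinh_sq_diff: "(sinh a)\<^sup>2 - (sinh b)\<^sup>2 = sinh (a + b) * sinh (a - b)" for a b :: real
  unfolding sinh_add sinh_diff using cosh_square_eq[of a] cosh_square_eq[of b] by algebra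

lemma abs_le_hyp: "\<bar>a\<bar> \<le> hyp a h"
proof -
  have "sinh \<bar>a\<bar> = sqrt ((sinh a)\<^sup>2)" by simp
  also have "\<dots> \<le> sinh (hyp a h)" unfolding sinh_hyp by (intro real_sqrt_le_mono) simp
  finally show ?thesis by (simp only: sinh_real_le_iff)
qed

lemma abs_less_hyp: "h \<noteq> 0 \<Longrightarrow> \<bar>a\<bar> < hyp a h"
proof -
  assume "h \<noteq> 0"
  then have "(sinh \<bar>a\<bar>)\<^sup>2 < (sinh (hyp a h))\<^sup>2" by (simp add: sinh_hyp_sq)
  then have "\<bar>a\<bar> \<noteq> hyp a h" by (metis less_irrefl)
  then show ?thesis using abs_le_hyp[of a h] by simp
qed

lemma hyp_nonneg: "0 \<le> hyp a h"
  using abs_le_hyp[of a h] by linarith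

lemma le_sinh: "0 \<le> x \<Longrightarrow> x \<le> sinh x" for x :: real
  by (metis real_le_x_sinh sinh_field_def exp_minus)

lemma sinh_add_superadditive:
  fixes x y :: real
  assumes "0 \<le> x" "0 \<le> y"
  shows "sinh x + sinh y \<le> sinh (x + y)"
proof -
  have "sinh x * 1 \<le> sinh x * cosh y" by (intro mult_left_mono cosh_real_ge_1) (simp add: assms)
  moreover have "1 * sinh y \<le> cosh x * sinh y" by (intro mult_right_mono cosh_real_ge_1) (simp add: assms)
  ultimately show ?thesis by (simp add: sinh_add)
qed

lemma abs_le_abs_sinh: "\<bar>x\<bar> \<le> \<bar>sinh x\<bar>" for x :: real
  using le_sinh[of "\<bar>x\<bar>"] by simp

lemma hyp_le: "hyp a h \<le> \<bar>a\<bar> + \<bar>h\<bar>"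
proof -
  have "sinh (hyp a h) \<le> \<bar>sinh a\<bar> + \<bar>h\<bar>"
    unfolding sinh_hyp by (rule sqrt_sum_squares_le_sum_abs)
  also have "\<dots> \<le> sinh \<bar>a\<bar> + sinh \<bar>h\<bar>"
    using abs_le_abs_sinh[of h] by simp
  also have "\<dots> \<le> sinh (\<bar>a\<bar> + \<bar>h\<bar>)" by (rule sinh_add_superadditive) auto
  finally show ?thesis by (simp only: sinh_real_le_iff)
qed

text \<open>Half the difference of the bounds \<open>1 + x + x^2\<close> for \<open>exp x\<close>
  and \<open>1 - x\<close> for \<open>exp (- x)\<close> is \<open>x + x^2 / 2\<close>, and
  \<open>x^2 \<le> x / 10\<close>.\<close>

lemma sinh_le:
  fixes x :: real
  assumes "0 \<le> x" "x \<le> 1/10"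
  shows "sinh x \<le> 21/20 * x"
proof -
  have "exp x \<le> 1 + x + x\<^sup>2" using assms by (intro exp_bound) auto
  moreover have "1 - x \<le> exp (- x)" using exp_ge_add_one_self[of "-x"] by simp
  moreover have "x * x \<le> 1/10 * x" using assms by (intro mult_right_mono) auto
  ultimately show ?thesis by (simp add: sinh_field_def power2_eq_square)
qed

text \<open>The sum-to-product formula writes the difference as twice \<open>cosh\<close> of the
  mean times \<open>sinh\<close> of half the difference; the bounds \<open>3/2\<close> and
  \<open>21/20\<close> for these factors leave a slope below 2.\<close>

lemma sinh_lipschitz:
  fixes x y :: real
  assumes "\<bar>x\<bar> \<le> 1/20" "\<bar>y\<bar> \<le> 1/20"
  shows "\<bar>sinh x - sinh y\<bar> \<le> 2 * \<bar>x - y\<bar>"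
proof -
  have *: "sinh u - sinh v \<le> 2 * (u - v)" if "v \<le> u" "\<bar>u\<bar> \<le> 1/20" "\<bar>v\<bar> \<le> 1/20" for u v :: real
  proof -
    let ?d = "(u - v) / 2" and ?s = "(u + v) / 2"
    have e: "sinh u - sinh v = 2 * (cosh ?s * sinh ?d)"
    proof -
      have "?s + ?d = u" "?s - ?d = v" by (simp_all add: field_simps)
      then show ?thesis using sinh_add[of ?s ?d] sinh_diff[of ?s ?d] by simp
    qed
    have "\<bar>sinh ?s\<bar> \<le> 1"
      using sinh_le[of "\<bar>?s\<bar>"] that by (auto simp: abs_if)
    then have "(cosh ?s)\<^sup>2 \<le> 1 + 1" unfolding cosh_square_eq
      by (simp add: abs_square_le_1)
    then have c: "cosh ?s \<le> 3/2"
      by (rule power2_le_imp_le[OF order_trans]) (simp_all add: power2_eq_square)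
    have "cosh ?s * sinh ?d \<le> 3/2 * (21/20 * ?d)"
      using that c by (intro mult_mono sinh_le) auto
    then show ?thesis unfolding e using that by (simp add: field_simps)
  qed
  show ?thesis
    using *[of x y] *[of y x] assms by (cases "x \<le> y") (auto simp: abs_if)
qed

lemma abs_fst_G: "\<bar>fst (G (a, h))\<bar> = (if a = 0 then 0 else \<bar>2 * \<bar>a\<bar> - hyp a h\<bar>)"
  by (simp add: G_def abs_mult sgn_if)

lemma abs_snd_G: "\<bar>snd (G (a, h))\<bar> = (if a = 0 then 0 else \<bar>h\<bar> * sinh (hyp a h - \<bar>a\<bar>))"
  using abs_le_hyp[of a h] by (simp add: G_def abs_mult flip: sinh_real_abs)

section \<open>The neighbourhood of the origin and the quadratic estimate\<close>

text \<open>The map \<open>param\<close> takes this square onto the required neighbourhood of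
  \<open>p0\<close>. The radius is small enough for all numerical estimates below.\<close>

definition cell :: "(real \<times> real) set" where
  "cell = {z. \<bar>fst z\<bar> < 1/100 \<and> \<bar>snd z\<bar> < 1/100}"

definition sector :: "(real \<times> real) set" where
  "sector = {z. \<bar>snd z\<bar> \<le> 3 * \<bar>fst z\<bar> \<and> \<bar>fst z\<bar> \<le> \<bar>snd z\<bar>}"

lemma snd_G_le:
  assumes "z \<in> cell"
  shows "\<bar>snd (G z)\<bar> \<le> 2 * \<bar>snd z\<bar>\<^sup>2"
proof -
  obtain a h where z: "z = (a, h)" by force
  have "sinh (hyp a h - \<bar>a\<bar>) \<le> sinh \<bar>h\<bar>" using hyp_le[of a h] by (simp del: sinh_real_abs)
  also have "\<dots> \<le> 2 * \<bar>h\<bar>"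
    using sinh_le[of "\<bar>h\<bar>"] assms unfolding z cell_def by simp
  finally have "\<bar>h\<bar> * sinh (hyp a h - \<bar>a\<bar>) \<le> \<bar>h\<bar> * (2 * \<bar>h\<bar>)" by (intro mult_left_mono) auto
  then show ?thesis by (auto simp: z abs_snd_G power2_eq_square)
qed

text \<open>A linear form of the quadratic bound, from \<open>2 * |h| \<le> 1/9\<close>; this is the
  contraction that is iterated.\<close>

lemma snd_G_le_ninth:
  assumes "z \<in> cell"
  shows "\<bar>snd (G z)\<bar> \<le> \<bar>snd z\<bar> / 9"
proof -
  have "2 * \<bar>snd z\<bar>\<^sup>2 = (2 * \<bar>snd z\<bar>) * \<bar>snd z\<bar>" by (simp add: power2_eq_square)
  also have "\<dots> \<le> 1/9 * \<bar>snd z\<bar>"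
    using assms by (intro mult_right_mono) (auto simp: cell_def)
  finally show ?thesis using snd_G_le[OF assms] by simp
qed

text \<open>From \<open>|a| \<le> b \<le> |a| + |h|\<close> the number \<open>2 * |a| - b\<close>
  lies between \<open>- |h|\<close> and \<open>|a|\<close>.\<close>

lemma G_cell:
  assumes "z \<in> cell" shows "G z \<in> cell"
proof -
  obtain a h where z: "z = (a, h)" by force
  have "\<bar>fst (G z)\<bar> < 1/100"
  proof -
    have "\<bar>a\<bar> < 1/100" "\<bar>h\<bar> < 1/100" using assms by (auto simp: cell_def z)
    then have "\<bar>2 * \<bar>a\<bar> - hyp a h\<bar> < 1/100" using abs_le_hyp[of a h] hyp_le[of a h] by linarith
    then show ?thesis unfolding z abs_fst_G by simp
  qed
  moreover have "\<bar>snd (G z)\<bar> < 1/100"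
    using snd_G_le_ninth[OF assms] assms by (auto simp: cell_def z)
  ultimately show ?thesis by (simp add: cell_def case_prod_beta)
qed

lemma G_iter_cell: "z \<in> cell \<Longrightarrow> (G ^^ k) z \<in> cell"
  by (induction k) (auto intro: G_cell)

text \<open>The product form of the relation defining \<open>b = hyp a h\<close>. It controls
  \<open>b - |a|\<close>, which is both the drift of \<open>|a|\<close> and, through
  \<open>sinh\<close>, the contraction of \<open>h\<close>.\<close>

lemma sinh_defect:
  "sinh (hyp a h - \<bar>a\<bar>) * sinh (hyp a h + \<bar>a\<bar>) = h\<^sup>2"
  using sinh_sq_diff[of "hyp a h" "\<bar>a\<bar>"] sinh_hyp_sq[of a h] by (simp add: mult.commute)

text \<open>In the sector \<open>b + |a| \<le> 3 * |h|\<close>, so the second factor in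
  \<open>sinh_defect\<close> is at most \<open>4 * |h|\<close> and the first is at least
  \<open>|h| / 4\<close>.\<close>

lemma snd_G_ge:
  assumes "z \<in> cell" "z \<in> sector"
  shows "\<bar>snd z\<bar>\<^sup>2 / 4 \<le> \<bar>snd (G z)\<bar>"
proof -
  obtain a h where z: "z = (a, h)" by force
  let ?t = "hyp a h - \<bar>a\<bar>"
  have t: "0 \<le> sinh ?t" using abs_le_hyp[of a h] by simp
  show ?thesis
  proof (cases "h = 0")
    case False
    then have a: "a \<noteq> 0" using assms by (auto simp: z sector_def)
    have "sinh (hyp a h + \<bar>a\<bar>) \<le> sinh (3 * \<bar>h\<bar>)"
      using hyp_le[of a h] assms by (auto simp: z sector_def)
    also have "\<dots> \<le> 4 * \<bar>h\<bar>"
      using sinh_le[of "3 * \<bar>h\<bar>"] assms unfolding z cell_def by auto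
    finally have "h\<^sup>2 \<le> sinh ?t * (4 * \<bar>h\<bar>)"
      unfolding sinh_defect[of a h, symmetric] using t by (intro mult_left_mono)
    then show ?thesis using a by (simp add: z abs_snd_G mult.commute)
  qed (simp add: z)
qed

section \<open>Escape from the sector\<close>

text \<open>Positive exactly beyond the outer boundary \<open>|a| = |h|\<close> of the sector; it
  serves as a Lyapunov function certifying escape.\<close>

definition excess :: "real \<times> real \<Rightarrow> real" where
  "excess z = \<bar>fst z\<bar> - \<bar>snd z\<bar>"

text \<open>Where \<open>|h| \<le> |a|\<close>, \<open>sinh_defect\<close> bounds
  \<open>b - |a|\<close> by \<open>|h| / 2\<close>. Thus \<open>|a|\<close> drops by at most
  \<open>|h| / 2\<close>, while \<open>|h|\<close> drops by at least
  \<open>8/9 * |h|\<close>.\<close>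

lemma excess_mono:
  assumes "z \<in> cell" "0 \<le> excess z"
  shows "excess z \<le> excess (G z)"
    and "snd z \<noteq> 0 \<Longrightarrow> excess z < excess (G z)"
proof -
  obtain a h where z: "z = (a, h)" by force
  let ?t = "hyp a h - \<bar>a\<bar>"
  have *: "excess z \<le> excess (G z) \<and> (h \<noteq> 0 \<longrightarrow> excess z < excess (G z))"
  proof (cases "a = 0")
    case False
    have t0: "0 \<le> ?t" using abs_le_hyp[of a h] by simp
    have "?t * (2 * \<bar>a\<bar>) \<le> sinh ?t * sinh (hyp a h + \<bar>a\<bar>)"
    proof (intro mult_mono)
      show "2 * \<bar>a\<bar> \<le> sinh (hyp a h + \<bar>a\<bar>)"
        using le_sinh[of "hyp a h + \<bar>a\<bar>"] abs_le_hyp[of a h] by linarith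
    qed (use t0 le_sinh in auto)
    also have "\<dots> \<le> \<bar>h\<bar> * \<bar>a\<bar>"
    proof -
      have "h\<^sup>2 = \<bar>h\<bar> * \<bar>h\<bar>" by (simp add: power2_eq_square)
      also have "\<dots> \<le> \<bar>h\<bar> * \<bar>a\<bar>"
        using assms by (intro mult_left_mono) (auto simp: z excess_def)
      finally show ?thesis unfolding sinh_defect .
    qed
    finally have t: "?t \<le> \<bar>h\<bar> / 2" using False by simp
    have "\<bar>snd (G z)\<bar> \<le> \<bar>h\<bar> / 9" using snd_G_le_ninth[OF assms(1)] by (simp add: z)
    then show ?thesis using t False unfolding excess_def z abs_fst_G by auto
  qed (use assms in \<open>auto simp: z excess_def G_def\<close>)
  then show "excess z \<le> excess (G z)" "snd z \<noteq> 0 \<Longrightarrow> excess z < excess (G z)"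
    by (auto simp: z)
qed

text \<open>On and inside the inner boundary \<open>b\<close> is at least \<open>9/10 * |h|\<close>,
  whereas \<open>2 * |a|\<close> is at most \<open>2/3 * |h|\<close>. So \<open>a\<close> changes
  sign, and its new size exceeds \<open>|h| / 9\<close>, a bound for the new height.\<close>

lemma excess_inner:
  assumes "z \<in> cell" "fst z \<noteq> 0" "snd z \<noteq> 0" "3 * \<bar>fst z\<bar> \<le> \<bar>snd z\<bar>"
  shows "2 * \<bar>fst z\<bar> < hyp (fst z) (snd z)" "0 < excess (G z)"
proof -
  obtain a h where z: "z = (a, h)" by force
  have h: "\<bar>h\<bar> < 1/100" and a: "3 * \<bar>a\<bar> \<le> \<bar>h\<bar>" "a \<noteq> 0" "h \<noteq> 0" using assms by (auto simp: z cell_def)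
  \<comment> \<open>The factor \<open>9/10\<close> absorbs the loss in \<open>sinh_le\<close>, since
    \<open>21/20 * 9/10 < 1\<close>.\<close>
  have "sinh (9/10 * \<bar>h\<bar>) \<le> 21/20 * (9/10 * \<bar>h\<bar>)" using h by (intro sinh_le) auto
  also have "\<dots> \<le> \<bar>h\<bar>" by simp
  also have "\<dots> \<le> sinh (hyp a h)" unfolding sinh_hyp by (intro real_le_rsqrt) simp
  finally have b: "9/10 * \<bar>h\<bar> \<le> hyp a h" by (simp only: sinh_real_le_iff)
  then show "2 * \<bar>fst z\<bar> < hyp (fst z) (snd z)" using a by (simp add: z)
  have "\<bar>snd (G z)\<bar> \<le> \<bar>h\<bar> / 9" using snd_G_le_ninth[OF assms(1)] by (simp add: z)
  then show "0 < excess (G z)" using a b unfolding excess_def z abs_fst_G by simp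
qed

text \<open>Here \<open>sinh_defect\<close> and \<open>|h| \<le> |a|\<close> give
  \<open>(b - |a|) * |a| < a^2\<close>, hence \<open>b < 2 * |a|\<close>: the sign of
  \<open>a\<close> is kept.\<close>

lemma excess_outer:
  assumes "z \<in> cell" "snd z \<noteq> 0" "\<bar>snd z\<bar> \<le> \<bar>fst z\<bar>"
  shows "hyp (fst z) (snd z) < 2 * \<bar>fst z\<bar>" "0 < excess (G z)"
proof -
  have e: "0 \<le> excess z" using assms by (simp add: excess_def)
  then show "0 < excess (G z)" using excess_mono(2)[OF assms(1) e assms(2)] by simp
  obtain a h where z: "z = (a, h)" by force
  let ?t = "hyp a h - \<bar>a\<bar>"
  have a: "0 < \<bar>a\<bar>" using assms by (auto simp: z)
  have h: "\<bar>h\<bar> \<le> \<bar>a\<bar>" "h \<noteq> 0" using assms by (auto simp: z)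
  have t0: "0 < ?t" using abs_less_hyp[OF h(2)] by simp
  have "\<bar>a\<bar> < sinh (hyp a h + \<bar>a\<bar>)" using le_sinh[of "hyp a h + \<bar>a\<bar>"] a abs_le_hyp[of a h] by linarith
  then have "?t * \<bar>a\<bar> < sinh ?t * sinh (hyp a h + \<bar>a\<bar>)"
    using t0 a le_sinh[of ?t] by (intro mult_le_less_imp_less) auto
  also have "\<dots> \<le> \<bar>a\<bar> * \<bar>a\<bar>"
    unfolding sinh_defect power2_eq_square using h mult_mono[OF h(1) h(1)] by simp
  finally have "?t < \<bar>a\<bar>" using a by (simp only: mult_less_cancel_right_pos)
  then show "hyp (fst z) (snd z) < 2 * \<bar>fst z\<bar>" by (simp add: z)
qed

section \<open>Trapped orbits\<close>

text \<open>A description of the stable set without limits; \<open>trapped_iff\<close> identifies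
  the two.\<close>

definition trapped :: "(real \<times> real) set" where
  "trapped = {z \<in> cell. \<forall>k. (G ^^ k) z \<in> sector}"

lemma trapped_cell: "z \<in> trapped \<Longrightarrow> z \<in> cell"
  by (simp add: trapped_def)

lemma trapped_sector: "z \<in> trapped \<Longrightarrow> z \<in> sector"
  using funpow_0[of G z] unfolding trapped_def by (metis (mono_tags, lifting) mem_Collect_eq)

lemma G_trapped: "z \<in> trapped \<Longrightarrow> G z \<in> trapped"
proof -
  assume z: "z \<in> trapped"
  then have "(G ^^ Suc k) z \<in> sector" for k unfolding trapped_def by blast
  then have "(G ^^ k) (G z) \<in> sector" for k by (simp only: funpow_Suc_right comp_apply)
  then show ?thesis using z by (simp add: trapped_def G_cell)
qed

lemma G_iter_trapped: "z \<in> trapped \<Longrightarrow> (G ^^ k) z \<in> trapped"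
  by (induction k) (auto intro: G_trapped)

lemma sector_fst_eq_0: "z \<in> sector \<Longrightarrow> fst z = 0 \<longleftrightarrow> snd z = 0"
  by (auto simp: sector_def)

lemma excess_iter:
  assumes "z \<in> cell" "0 \<le> excess z"
  shows "excess z \<le> excess ((G ^^ k) z)"
proof (induction k)
  case (Suc k)
  then have "0 \<le> excess ((G ^^ k) z)" using assms by linarith
  then show ?case using Suc excess_mono(1)[OF G_iter_cell[OF assms(1)], of k] by simp
qed simp

text \<open>The function \<open>excess\<close> is continuous and vanishes at the origin, but along
  this orbit it stays above its positive initial value.\<close>

lemma excess_pos_not_tendsto:
  assumes "z \<in> cell" "0 < excess z"
  shows "\<not> (\<lambda>k. (G ^^ k) z) \<longlonglongrightarrow> (0, 0)"
proof
  assume "(\<lambda>k. (G ^^ k) z) \<longlonglongrightarrow> (0, 0)"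
  then have "(\<lambda>k. excess ((G ^^ k) z)) \<longlonglongrightarrow> \<bar>fst (0::real, 0::real)\<bar> - \<bar>snd (0::real, 0::real)\<bar>"
    unfolding excess_def by (intro tendsto_intros)
  then have "(\<lambda>k. excess ((G ^^ k) z)) \<longlonglongrightarrow> 0" by simp
  moreover have "\<forall>k. excess z \<le> excess ((G ^^ k) z)" using excess_iter assms by auto
  ultimately have "excess z \<le> 0" by (intro LIMSEQ_le_const) auto
  then show False using assms by simp
qed

text \<open>An iterate outside the sector has positive excess or acquires it in the next step, and
  neither is compatible with convergence. The assumption \<open>nz\<close> expresses that the orbit
  is defined: \<open>G\<close> sends the whole line \<open>a = 0\<close> to the origin by
  convention.\<close>

lemma tendsto_imp_trapped:
  assumes "z \<in> cell" and lim: "(\<lambda>k. (G ^^ k) z) \<longlonglongrightarrow> (0, 0)"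
    and nz: "\<And>k. fst ((G ^^ k) z) = 0 \<Longrightarrow> (G ^^ k) z = (0, 0)"
  shows "z \<in> trapped"
proof -
  have "(G ^^ k) z \<in> sector" for k
  proof (rule ccontr)
    let ?w = "(G ^^ k) z"
    assume ns: "?w \<notin> sector"
    have shift: "(\<lambda>j. (G ^^ j) ((G ^^ i) z)) \<longlonglongrightarrow> (0, 0)" for i
      using LIMSEQ_ignore_initial_segment[OF lim, of i] by (simp add: funpow_add)
    have w: "?w \<in> cell" using assms(1) by (rule G_iter_cell)
    have nz': "fst ?w \<noteq> 0" using nz[of k] ns by (auto simp: sector_def)
    have no: "\<not> 0 < excess ((G ^^ i) z)" for i
      using excess_pos_not_tendsto[OF G_iter_cell[OF assms(1)]] shift by blast
    have "\<not> \<bar>snd ?w\<bar> < \<bar>fst ?w\<bar>" using no[of k] by (simp add: excess_def)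
    then have "3 * \<bar>fst ?w\<bar> \<le> \<bar>snd ?w\<bar>" using ns unfolding sector_def mem_Collect_eq by linarith
    then have "0 < excess (G ?w)" using nz' w by (intro excess_inner) auto
    then show False using no[of "Suc k"] by simp
  qed
  then show ?thesis using assms(1) by (simp add: trapped_def)
qed

lemma snd_iter_le:
  assumes "z \<in> cell"
  shows "\<bar>snd ((G ^^ k) z)\<bar> \<le> (1/9) ^ k"
proof (induction k)
  case 0 show ?case using assms by (simp add: cell_def)
next
  case (Suc k)
  then show ?case using snd_G_le_ninth[OF G_iter_cell[OF assms], of k] by simp
qed

text \<open>Heights decay geometrically, and in the sector \<open>|a| \<le> |h|\<close>.\<close>

lemma trapped_tendsto:
  assumes "z \<in> trapped"
  shows "(\<lambda>k. (G ^^ k) z) \<longlonglongrightarrow> (0, 0)"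
proof -
  have s: "\<bar>snd ((G ^^ k) z)\<bar> \<le> (1/9) ^ k" for k
    using snd_iter_le trapped_cell[OF assms] by auto
  have f: "\<bar>fst ((G ^^ k) z)\<bar> \<le> (1/9) ^ k" for k
    using s[of k] trapped_sector[OF G_iter_trapped[OF assms], of k] by (auto simp: sector_def)
  have l: "(\<lambda>k. (1/9::real) ^ k) \<longlonglongrightarrow> 0" by (intro LIMSEQ_power_zero) simp
  have "(\<lambda>k. fst ((G ^^ k) z)) \<longlonglongrightarrow> 0" "(\<lambda>k. snd ((G ^^ k) z)) \<longlonglongrightarrow> 0"
    using s f by (auto intro!: tendsto_rabs_zero_cancel[OF tendsto_sandwich[OF _ _ tendsto_const l]])
  then have "(\<lambda>k. (fst ((G ^^ k) z), snd ((G ^^ k) z))) \<longlonglongrightarrow> (0, 0)" by (rule tendsto_Pair)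
  then show ?thesis by simp
qed

section \<open>Continuity of the step and closedness of the trapped set\<close>

lemma continuous_on_hyp [continuous_intros]:
  "continuous_on S f \<Longrightarrow> continuous_on S g \<Longrightarrow> continuous_on S (\<lambda>z. hyp (f z) (g z))"
  unfolding hyp_def
  by (rule continuous_on_compose2[OF continuous_on_arsinh[of UNIV]]) (auto intro!: continuous_intros)

text \<open>The sector meets the line \<open>a = 0\<close> only at the origin, where the formulas
  for the two signs of \<open>a\<close> agree.\<close>

lemma continuous_on_G: "continuous_on sector G"
proof -
  let ?f = "\<lambda>z. (2 * fst z + hyp (fst z) (snd z), snd z * sinh (hyp (fst z) (snd z) + fst z))"
  let ?g = "\<lambda>z. (2 * fst z - hyp (fst z) (snd z), snd z * sinh (hyp (fst z) (snd z) - fst z))"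
  have "continuous_on sector (\<lambda>z. if fst z \<le> 0 then ?f z else ?g z)"
  proof (rule continuous_on_cases_le)
    show "?f z = ?g z" if "z \<in> sector" "fst z = 0" for z
      using that sector_fst_eq_0[OF that(1)] by (simp add: hyp_zero)
  qed (intro continuous_intros)+
  moreover have "(if fst z \<le> 0 then ?f z else ?g z) = G z" if "z \<in> sector" for z
    using sector_fst_eq_0[OF that] by (cases z) (auto simp: G_def hyp_zero sgn_if)
  ultimately show ?thesis by (simp cong: continuous_on_cong)
qed

lemma continuous_on_G_iter: "continuous_on trapped (G ^^ k)"
proof (induction k)
  case 0 show ?case by (simp add: id_def)
next
  case (Suc k)
  have "continuous_on ((G ^^ k) ` trapped) G"
    using trapped_sector[OF G_iter_trapped] by (intro continuous_on_subset[OF continuous_on_G]) auto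
  then show ?case using continuous_on_compose[OF Suc] by simp
qed

lemma closed_sector: "closed sector"
  unfolding sector_def by (intro closed_Collect_conj closed_Collect_le continuous_intros)

text \<open>Continuity of \<open>G\<close> is available on the sector only, so the induction carries
  along that each iterate of the limit lies there.\<close>

lemma trapped_closed_seq:
  assumes z: "\<And>n. z n \<in> trapped" and l: "z \<longlonglongrightarrow> l" "l \<in> cell"
  shows "l \<in> trapped"
proof -
  have "(\<lambda>n. (G ^^ k) (z n)) \<longlonglongrightarrow> (G ^^ k) l \<and> (G ^^ k) l \<in> sector" for k
  proof (induction k)
    case 0
    show ?case using l closed_sequentially[OF closed_sector _ l(1)] trapped_sector[OF z] by auto
  next
    case (Suc k)
    have s: "(G ^^ j) (z n) \<in> sector" for j n using trapped_sector G_iter_trapped z by auto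
    have "(\<lambda>n. G ((G ^^ k) (z n))) \<longlonglongrightarrow> G ((G ^^ k) l)"
      using Suc s by (intro continuous_on_tendsto_compose[OF continuous_on_G]) auto
    then have *: "(\<lambda>n. (G ^^ Suc k) (z n)) \<longlonglongrightarrow> (G ^^ Suc k) l" by simp
    then show ?case using closed_sequentially[OF closed_sector _ *] s[of "Suc k"] by blast
  qed
  then show ?thesis using l by (auto simp: trapped_def)
qed

section \<open>Expansion along nearly horizontal directions\<close>

text \<open>Both sides of \<open>sinh\<^sup>2 b = sinh\<^sup>2 a + h\<^sup>2\<close> are differenced with \<open>sinh\<^sup>2 u - sinh\<^sup>2 v = sinh (u + v) sinh (u - v)\<close>; the constant \<open>3/4\<close> comes
  from \<open>sinh b \<ge> 4/3 sinh a\<close>, valid where \<open>a \<le> h\<close>.\<close>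
lemma hyp_diff_le:
  assumes "0 \<le> a1" "a1 \<le> h1" "h1 \<le> 1/100" "0 \<le> a2" "a2 \<le> h2" "h2 \<le> 1/100" "0 < h1"
  shows "\<bar>hyp a1 h1 - hyp a2 h2\<bar> \<le> 3/4 * sinh \<bar>a1 - a2\<bar> + \<bar>h1 - h2\<bar>"
proof -
  let ?b1 = "hyp a1 h1" and ?b2 = "hyp a2 h2"
  let ?s = "sinh (?b1 + ?b2)"
  have b: "a1 \<le> ?b1" "a2 \<le> ?b2" using abs_le_hyp[of a1 h1] abs_le_hyp[of a2 h2] by auto
  have sb: "4/3 * sinh a \<le> sinh (hyp a h)" if "0 \<le> a" "a \<le> h" "h \<le> 1/100" for a h
  proof -
    have "sinh a \<le> 21/20 * h" using sinh_le[of a] that by simp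
    then have "(sinh a)\<^sup>2 \<le> (21/20 * h)\<^sup>2" using that by (intro power_mono) auto
    \<comment> \<open>The claim amounts to \<open>7/9 * (sinh a)^2 \<le> h^2\<close>, and
      \<open>7/9 * (21/20)^2 < 1\<close>.\<close>
    then have "(4/3 * sinh a)\<^sup>2 \<le> (sinh a)\<^sup>2 + h\<^sup>2"
      using zero_le_power2[of h] unfolding power_mult_distrib by (simp add: power2_eq_square del: zero_le_square)
    then show ?thesis unfolding sinh_hyp by (intro real_le_rsqrt)
  qed
  have hb: "h \<le> sinh (hyp a h)" for a h
    unfolding sinh_hyp by (intro real_le_rsqrt) simp
  have "h1 + h2 \<le> sinh ?b1 + sinh ?b2" using hb[of h1 a1] hb[of h2 a2] by simp
  also have "\<dots> \<le> ?s" by (intro sinh_add_superadditive hyp_nonneg)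
  finally have hs: "h1 + h2 \<le> ?s" .
  then have s: "0 < ?s" using assms by linarith
  have c: "cosh a1 \<le> cosh ?b1" "cosh a2 \<le> cosh ?b2"
    using b assms by (simp_all add: cosh_real_nonneg_le_iff hyp_nonneg)
  have "sinh a1 * cosh a2 \<le> (3/4 * sinh ?b1) * cosh ?b2"
    using sb[of a1 h1] c assms by (intro mult_mono) (auto simp: hyp_nonneg)
  moreover have "cosh a1 * sinh a2 \<le> cosh ?b1 * (3/4 * sinh ?b2)"
    using sb[of a2 h2] c assms by (intro mult_mono) auto
  ultimately have as: "sinh (a1 + a2) \<le> 3/4 * ?s" by (simp add: sinh_add algebra_simps)
  have "sinh (?b1 - ?b2) * ?s = sinh (a1 - a2) * sinh (a1 + a2) + (h1 - h2) * (h1 + h2)"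
    using sinh_sq_diff[of ?b1 ?b2] sinh_sq_diff[of a1 a2]
      sinh_hyp_sq[of a1 h1] sinh_hyp_sq[of a2 h2]
    by (simp add: algebra_simps power2_eq_square)
  then have "\<bar>sinh (?b1 - ?b2) * ?s\<bar> \<le> \<bar>sinh (a1 - a2) * sinh (a1 + a2)\<bar> + \<bar>(h1 - h2) * (h1 + h2)\<bar>"
    by linarith
  also have "\<dots> = \<bar>sinh (a1 - a2)\<bar> * sinh (a1 + a2) + \<bar>h1 - h2\<bar> * (h1 + h2)"
    using assms by (simp add: abs_mult)
  also have "\<dots> \<le> \<bar>sinh (a1 - a2)\<bar> * (3/4 * ?s) + \<bar>h1 - h2\<bar> * ?s"
    using as hs by (intro add_mono mult_left_mono) auto
  finally have "\<bar>sinh (?b1 - ?b2)\<bar> * ?s \<le> (3/4 * \<bar>sinh (a1 - a2)\<bar> + \<bar>h1 - h2\<bar>) * ?s"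
    using s by (simp add: abs_mult algebra_simps)
  then have "\<bar>sinh (?b1 - ?b2)\<bar> \<le> 3/4 * \<bar>sinh (a1 - a2)\<bar> + \<bar>h1 - h2\<bar>"
    using s by (simp only: mult_le_cancel_right_pos)
  then show ?thesis using abs_le_abs_sinh[of "?b1 - ?b2"] by simp
qed

text \<open>Forward invariance of the horizontal cone of slope \<open>1/8\<close>: the first
  coordinate is doubled minus a variation of \<open>b\<close> smaller than the original distance,
  while the second is multiplied by small factors.\<close>

lemma cone_step:
  assumes z: "z1 \<in> cell" "z1 \<in> sector" "z2 \<in> cell" "z2 \<in> sector"
    and pos: "0 < snd z1" "0 < snd z2"
    and sgn: "sgn (fst z1) = sgn (fst z2)"
    and cone: "\<bar>snd z1 - snd z2\<bar> \<le> \<bar>fst z1 - fst z2\<bar> / 8"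
  shows "\<bar>fst z1 - fst z2\<bar> \<le> \<bar>fst (G z1) - fst (G z2)\<bar>"
    and "\<bar>snd (G z1) - snd (G z2)\<bar> \<le> \<bar>fst (G z1) - fst (G z2)\<bar> / 8"
proof -
  obtain a1 h1 a2 h2 where e: "z1 = (a1, h1)" "z2 = (a2, h2)" by force
  let ?b1 = "hyp a1 h1" and ?b2 = "hyp a2 h2"
  let ?t1 = "?b1 - \<bar>a1\<bar>" and ?t2 = "?b2 - \<bar>a2\<bar>"
  define D where "D = \<bar>a1 - a2\<bar>"
  have nz: "a1 \<noteq> 0" "a2 \<noteq> 0" using z pos by (auto simp: e sector_def)
  have D: "D = \<bar>\<bar>a1\<bar> - \<bar>a2\<bar>\<bar>" using sgn unfolding D_def e by (auto simp: sgn_if split: if_splits)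
  have h: "\<bar>a1\<bar> \<le> h1" "h1 < 1/100" "\<bar>a2\<bar> \<le> h2" "h2 < 1/100" "0 < h1" "0 < h2"
    using z pos by (auto simp: e cell_def sector_def)
  have dh: "\<bar>h1 - h2\<bar> \<le> D / 8" using cone by (simp add: e D_def)
  have "sinh D \<le> 21/20 * D"
  proof (rule sinh_le)
    show "D \<le> 1/10" using h unfolding D by (simp only: abs_le_iff) linarith
  qed (simp add: D)
  moreover have "\<bar>?b1 - ?b2\<bar> \<le> 3/4 * sinh D + \<bar>h1 - h2\<bar>"
    using hyp_diff_le[of "\<bar>a1\<bar>" h1 "\<bar>a2\<bar>" h2] h unfolding D
    by (simp add: hyp_def)
  \<comment> \<open>Numerically \<open>3/4 * 21/20 + 1/8 < 37/40\<close>, so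
    \<open>2 * |a| - b\<close> stretches distances by at least \<open>2 - 37/40 > 1\<close>.\<close>
  ultimately have db: "\<bar>?b1 - ?b2\<bar> \<le> 37/40 * D" using dh by linarith
  have "fst (G z1) - fst (G z2) = sgn a1 * ((2 * \<bar>a1\<bar> - ?b1) - (2 * \<bar>a2\<bar> - ?b2))"
    using nz sgn by (simp add: e G_def algebra_simps)
  then have "\<bar>fst (G z1) - fst (G z2)\<bar> = \<bar>(2 * \<bar>a1\<bar> - ?b1) - (2 * \<bar>a2\<bar> - ?b2)\<bar>"
    using nz by (simp add: abs_mult sgn_if)
  then show exp: "\<bar>fst z1 - fst z2\<bar> \<le> \<bar>fst (G z1) - fst (G z2)\<bar>"
    using db D D_def unfolding e fst_conv by linarith
  have t: "0 \<le> ?t1" "?t1 \<le> h1" "0 \<le> ?t2" "?t2 \<le> h2"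
    using abs_le_hyp[of a1 h1] hyp_le[of a1 h1] abs_le_hyp[of a2 h2] hyp_le[of a2 h2] h by auto
  have "\<bar>?t1 - ?t2\<bar> \<le> 2 * D" using db D by linarith
  then have "\<bar>sinh ?t1 - sinh ?t2\<bar> \<le> 4 * D"
    using sinh_lipschitz[of ?t1 ?t2] t h by auto
  then have 1: "h2 * \<bar>sinh ?t1 - sinh ?t2\<bar> \<le> 1/100 * (4 * D)"
    using h by (intro mult_mono) auto
  have "\<bar>sinh ?t1\<bar> \<le> 1/10" using sinh_le[of ?t1] t h by auto
  then have 2: "\<bar>h1 - h2\<bar> * \<bar>sinh ?t1\<bar> \<le> D / 8 * (1/10)"
    using dh by (intro mult_mono) (auto simp: D_def)
  have "snd (G z1) - snd (G z2) = (h1 - h2) * sinh ?t1 + h2 * (sinh ?t1 - sinh ?t2)"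
    using nz by (simp add: e G_def algebra_simps)
  then have "\<bar>snd (G z1) - snd (G z2)\<bar> \<le> \<bar>h1 - h2\<bar> * \<bar>sinh ?t1\<bar> + h2 * \<bar>sinh ?t1 - sinh ?t2\<bar>"
    using h by (metis abs_mult abs_of_pos abs_triangle_ineq)
  \<comment> \<open>The two contributions add up to \<open>D / 80 + D / 25\<close>, below
    \<open>D / 8\<close>.\<close>
  then have "\<bar>snd (G z1) - snd (G z2)\<bar> \<le> D / 8"
    using 1 2 abs_ge_zero[of "a1 - a2"] unfolding D_def by linarith
  then show "\<bar>snd (G z1) - snd (G z2)\<bar> \<le> \<bar>fst (G z1) - fst (G z2)\<bar> / 8"
    using exp by (simp add: e D_def)
qed

section \<open>Coding by the middle-thirds Cantor set\<close>

lemma cantor_approx_subset: "cantor_approx n \<subseteq> {0..1}"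
  by (induction n) auto

lemma cantor_set_subset: "cantor_set \<subseteq> {0..1}"
  using cantor_approx_subset[of 0] unfolding cantor_set_def by blast

text \<open>The two pieces of each approximation lie in \<open>[0, 1/3]\<close> and
  \<open>[2/3, 1]\<close>; comparing with \<open>1/2\<close> tells which one contains
  \<open>c\<close>.\<close>

lemma cantor_set_expand:
  assumes "c \<in> cantor_set"
  shows "c \<le> 1/2 \<Longrightarrow> 3 * c \<in> cantor_set" and "1/2 < c \<Longrightarrow> 3 * c - 2 \<in> cantor_set"
proof -
  have *: "c \<in> (\<lambda>t. t / 3) ` cantor_approx n \<union> (\<lambda>t. t / 3 + 2 / 3) ` cantor_approx n" for n
    using assms unfolding cantor_set_def by (metis INT_iff UNIV_I cantor_approx.simps(2))
  have "3 * c \<in> cantor_approx n" if "c \<le> 1/2" for n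
    using *[of n] that cantor_approx_subset[of n] by auto
  then show "c \<le> 1/2 \<Longrightarrow> 3 * c \<in> cantor_set" by (simp add: cantor_set_def)
  have "3 * c - 2 \<in> cantor_approx n" if "1/2 < c" for n
    using *[of n] that cantor_approx_subset[of n] by auto
  then show "1/2 < c \<Longrightarrow> 3 * c - 2 \<in> cantor_set" by (simp add: cantor_set_def)
qed

lemma closed_cantor_set: "closed cantor_set"
proof -
  have "compact (cantor_approx n)" for n
    by (induction n) (auto intro!: compact_Un compact_continuous_image continuous_intros)
  then show ?thesis unfolding cantor_set_def by (intro closed_INT) (simp add: compact_imp_closed)
qed

text \<open>Self-similarity: two copies scaled by \<open>1/3\<close> cover the set, so its measure,
  finite by compactness, is at most \<open>2/3\<close> of itself.\<close>

lemma negligible_cantor_set: "negligible cantor_set"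
proof -
  let ?L = "(\<lambda>t. (1/3) *\<^sub>R t + 0) ` cantor_set" and ?R = "(\<lambda>t. (1/3) *\<^sub>R t + 2/3) ` cantor_set"
  have cpt: "compact cantor_set"
    using closed_cantor_set cantor_set_subset bounded_subset compact_eq_bounded_closed bounded_closed_interval by blast
  have m: "cantor_set \<in> lmeasurable" "?L \<in> lmeasurable" "?R \<in> lmeasurable"
    using cpt by (auto intro!: lmeasurable_compact compact_continuous_image continuous_intros)
  have "cantor_set \<subseteq> ?L \<union> ?R"
  proof
    fix c assume c: "c \<in> cantor_set"
    show "c \<in> ?L \<union> ?R"
    proof (cases "c \<le> 1/2")
      case True
      then show ?thesis using cantor_set_expand(1)[OF c] by (auto intro!: image_eqI[of _ _ "3 * c"])
    next
      case False
      then show ?thesis using cantor_set_expand(2)[OF c] by (intro UnI2 image_eqI[of _ _ "3 * c - 2"]) (auto simp: field_simps)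
    qed
  qed
  then have "measure lebesgue cantor_set \<le> measure lebesgue (?L \<union> ?R)"
    using m by (intro measure_mono_fmeasurable) (auto intro: fmeasurable.Un)
  also have "\<dots> \<le> measure lebesgue ?L + measure lebesgue ?R"
    using m by (intro measure_Un_le) auto
  also have "\<dots> = 1/3 * measure lebesgue cantor_set + 1/3 * measure lebesgue cantor_set"
    using measure_lebesgue_affine[of "1/3::real" 0 cantor_set] measure_lebesgue_affine[of "1/3::real" "2/3" cantor_set]
    by simp
  finally have "measure lebesgue cantor_set = 0" using measure_nonneg[of lebesgue cantor_set] by linarith
  then show ?thesis using m(1) negligible_iff_measure by blast
qed

section \<open>Ternary code of the signs of an orbit\<close>

text \<open>The ternary digit is 0 for negative and 2 for positive first coordinate; the digit 1
  arises only for a vanishing one, which orbits in \<open>trapped_up\<close> never have.\<close>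

definition code :: "real \<times> real \<Rightarrow> real" where
  "code z = (\<Sum>k. (1 + sgn (fst ((G ^^ k) z))) / 3 ^ Suc k)"

lemma sgn_bounds: "0 \<le> 1 + sgn a" "1 + sgn a \<le> 2" for a :: real
  by (auto simp: sgn_if)

lemma geometric_thirds: "(\<lambda>k. 2 / 3 ^ Suc k :: real) sums 1"
  using sums_mult[OF geometric_sums[of "1/3::real"], of "2/3"] by (simp add: power_divide)

lemma summable_code: "summable (\<lambda>k. (1 + sgn (fst ((G ^^ k) z))) / 3 ^ Suc k)"
proof (rule summable_comparison_test'[OF sums_summable[OF geometric_thirds]])
  show "norm ((1 + sgn (fst ((G ^^ n) z))) / 3 ^ Suc n) \<le> 2 / 3 ^ Suc n" for n
    using sgn_bounds[of "fst ((G ^^ n) z)"] by (simp add: divide_right_mono abs_mult)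
qed

text \<open>\<open>G\<close> acts on codes as the shift of digits.\<close>

lemma code_unfold: "code z = (1 + sgn (fst z)) / 3 + code (G z) / 3"
proof -
  let ?f = "\<lambda>k. (1 + sgn (fst ((G ^^ k) z))) / 3 ^ Suc k"
  have "code z = ?f 0 + (\<Sum>k. ?f (Suc k))"
    using suminf_split_head[OF summable_code[of z]] by (simp add: code_def)
  also have "(\<Sum>k. ?f (Suc k)) = (\<Sum>k. (1 + sgn (fst ((G ^^ k) (G z)))) / 3 ^ Suc k / 3)"
    by (simp add: funpow_swap1)
  also have "\<dots> = code (G z) / 3"
    unfolding code_def by (rule suminf_divide[OF summable_code])
  finally show ?thesis by simp
qed

lemma code_bounds: "0 \<le> code z" "code z \<le> 1"
proof -
  show "0 \<le> code z" unfolding code_def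
    by (intro suminf_nonneg summable_code divide_nonneg_nonneg sgn_bounds) simp
  have "code z \<le> (\<Sum>k. 2 / 3 ^ Suc k)" unfolding code_def
    by (intro suminf_le summable_code sums_summable[OF geometric_thirds] divide_right_mono sgn_bounds) simp
  then show "code z \<le> 1" using sums_unique[OF geometric_thirds] by simp
qed

definition trapped_up :: "(real \<times> real) set" where
  "trapped_up = {z \<in> trapped. 0 < snd z}"

lemma trapped_up_fst: "z \<in> trapped_up \<Longrightarrow> fst z \<noteq> 0"
  using sector_fst_eq_0[of z] trapped_sector[of z] by (auto simp: trapped_up_def)

lemma snd_G_pos:
  assumes "fst z \<noteq> 0" "0 < snd z" shows "0 < snd (G z)"
  using assms abs_less_hyp[of "snd z" "fst z"] by (cases z) (auto simp: G_def)

lemma G_trapped_up: "z \<in> trapped_up \<Longrightarrow> G z \<in> trapped_up"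
  using trapped_up_fst[of z] snd_G_pos[of z] G_trapped[of z] by (auto simp: trapped_up_def)

lemma G_iter_trapped_up: "z \<in> trapped_up \<Longrightarrow> (G ^^ k) z \<in> trapped_up"
  by (induction k) (auto intro: G_trapped_up)

lemma code_cases:
  assumes "z \<in> trapped_up"
  obtains "sgn (fst z) = 1" "code z = code (G z) / 3 + 2/3" | "sgn (fst z) = -1" "code z = code (G z) / 3"
  using trapped_up_fst[OF assms] code_unfold[of z] by (cases "fst z > 0") auto

lemma code_cantor: "z \<in> trapped_up \<Longrightarrow> code z \<in> cantor_set"
proof -
  have "z \<in> trapped_up \<Longrightarrow> code z \<in> cantor_approx n" for n
  proof (induction n arbitrary: z)
    case 0
    show ?case using code_bounds[of z] by simp
  next
    case (Suc n)
    have "code (G z) \<in> cantor_approx n" using Suc.IH[OF G_trapped_up[OF Suc.prems]] .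
    with Suc.prems show ?case by (cases rule: code_cases) auto
  qed
  then show "z \<in> trapped_up \<Longrightarrow> code z \<in> cantor_set" by (simp add: cantor_set_def)
qed

text \<open>The factor \<open>m\<close> compensates the growth of the code difference by \<open>3\<close> in each step.\<close>
lemma cone_fst_le:
  assumes "z1 \<in> trapped_up" "z2 \<in> trapped_up" "snd z1 \<le> m" "snd z2 \<le> m"
    and "\<bar>snd z1 - snd z2\<bar> \<le> \<bar>fst z1 - fst z2\<bar> / 8"
  shows "\<bar>fst z1 - fst z2\<bar> \<le> 6 * m * (\<bar>code z1 - code z2\<bar> + (1/3) ^ n)"
  using assms
proof (induction n arbitrary: z1 z2 m)
  case (0 z1 z2 m)
  have s: "\<bar>fst z1\<bar> \<le> m" "\<bar>fst z2\<bar> \<le> m"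
    using 0 trapped_sector[of z1] trapped_sector[of z2] by (auto simp: trapped_up_def sector_def)
  then have "\<bar>fst z1 - fst z2\<bar> \<le> 6 * m * 1" by linarith
  also have "\<dots> \<le> 6 * m * (\<bar>code z1 - code z2\<bar> + (1/3) ^ 0)"
    using s by (intro mult_left_mono) auto
  finally show ?case .
next
  case (Suc n z1 z2 m)
  note z = Suc.prems
  have s: "\<bar>fst z1\<bar> \<le> m" "\<bar>fst z2\<bar> \<le> m"
    using z trapped_sector[of z1] trapped_sector[of z2] by (auto simp: trapped_up_def sector_def)
  have c: "z1 \<in> cell" "z2 \<in> cell" "z1 \<in> sector" "z2 \<in> sector" "0 < snd z1" "0 < snd z2"
    using z trapped_sector trapped_cell by (auto simp: trapped_up_def)
  show ?case
  proof (cases "sgn (fst z1) = sgn (fst z2)")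
    case True
    note step = cone_step[OF c(1,3,2,4,5,6) True z(5)]
    have g: "G z1 \<in> trapped_up" "G z2 \<in> trapped_up" using z G_trapped_up by auto
    have m: "snd (G z1) \<le> m / 3" "snd (G z2) \<le> m / 3"
      using snd_G_le_ninth[OF c(1)] snd_G_le_ninth[OF c(2)] c z by auto
    have d: "\<bar>code (G z1) - code (G z2)\<bar> = 3 * \<bar>code z1 - code z2\<bar>"
      using code_unfold[of z1] code_unfold[of z2] True by (simp add: abs_if)
    have "\<bar>fst z1 - fst z2\<bar> \<le> \<bar>fst (G z1) - fst (G z2)\<bar>" by (rule step(1))
    also have "\<dots> \<le> 6 * (m / 3) * (\<bar>code (G z1) - code (G z2)\<bar> + (1/3) ^ n)"
      by (rule Suc.IH[OF g m step(2)])
    also have "\<dots> = 6 * m * (\<bar>code z1 - code z2\<bar> + (1/3) ^ Suc n)"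
      unfolding d by (simp add: field_simps)
    finally show ?thesis .
  next
    case False
    \<comment> \<open>Different signs put the codes on opposite sides of the middle gap, and
      \<open>2 * m = 6 * m * (1/3)\<close>; this is the source of the constant 6.\<close>
    have d: "1/3 \<le> \<bar>code z1 - code z2\<bar>"
      by (rule code_cases[OF z(1)]; rule code_cases[OF z(2)])
        (use False code_bounds[of "G z1"] code_bounds[of "G z2"] in auto)
    have "\<bar>fst z1 - fst z2\<bar> \<le> 6 * m * (1/3)" using s by simp
    also have "\<dots> \<le> 6 * m * (\<bar>code z1 - code z2\<bar> + (1/3) ^ Suc n)"
      using s d by (intro mult_left_mono add_increasing2) auto
    finally show ?thesis .
  qed
qed

text \<open>Outside the cone the first term alone suffices. Inside it, \<open>cone_fst_le\<close>
  applies for every \<open>n\<close>, and the power of \<open>1/3\<close> vanishes in the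
  limit.\<close>

lemma fst_diff_le:
  assumes z: "z1 \<in> trapped_up" "z2 \<in> trapped_up"
  shows "\<bar>fst z1 - fst z2\<bar> \<le> 8 * \<bar>snd z1 - snd z2\<bar> + \<bar>code z1 - code z2\<bar>"
proof (cases "\<bar>snd z1 - snd z2\<bar> \<le> \<bar>fst z1 - fst z2\<bar> / 8")
  case True
  \<comment> \<open>With \<open>m = 1/6\<close> the factor \<open>6 * m\<close> is 1.\<close>
  have m: "snd z1 \<le> 1/6" "snd z2 \<le> 1/6"
    using z by (auto simp: trapped_up_def trapped_def cell_def)
  have "(\<lambda>n. 6 * (1/6) * (\<bar>code z1 - code z2\<bar> + (1/3) ^ n)) \<longlonglongrightarrow> 6 * (1/6) * (\<bar>code z1 - code z2\<bar> + 0)"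
    by (intro tendsto_intros LIMSEQ_power_zero) simp
  then have "\<bar>fst z1 - fst z2\<bar> \<le> 6 * (1/6) * (\<bar>code z1 - code z2\<bar> + 0)"
    by (rule LIMSEQ_le_const) (use cone_fst_le[OF z m True] in auto)
  then show ?thesis by (simp add: add_increasing)
qed auto

text \<open>Each digit is continuous because the first coordinate never vanishes along the orbit,
  and the series converges uniformly.\<close>

lemma continuous_on_code: "continuous_on trapped_up code"
proof -
  let ?f = "\<lambda>k z. (1 + sgn (fst ((G ^^ k) z))) / 3 ^ Suc k"
  have "uniform_limit trapped_up (\<lambda>n z. \<Sum>k<n. ?f k z) (\<lambda>z. \<Sum>k. ?f k z) sequentially"
  proof (rule Weierstrass_m_test[OF _ sums_summable[OF geometric_thirds]])
    show "norm (?f n z) \<le> 2 / 3 ^ Suc n" for n z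
      using sgn_bounds[of "fst ((G ^^ n) z)"] by (simp add: divide_right_mono abs_mult)
  qed
  moreover have "continuous_on trapped_up (\<lambda>z. \<Sum>k<n. ?f k z)" for n
  proof -
    have "continuous_on trapped_up (\<lambda>z. sgn (fst ((G ^^ k) z)))" for k
    proof (rule continuous_on_sgn)
      have "continuous_on trapped_up (G ^^ k)"
        by (rule continuous_on_subset[OF continuous_on_G_iter]) (auto simp: trapped_up_def)
      then show "continuous_on trapped_up (\<lambda>z. fst ((G ^^ k) z))" by (rule continuous_on_fst)
      show "\<forall>z\<in>trapped_up. fst ((G ^^ k) z) \<noteq> 0" using trapped_up_fst G_iter_trapped_up by blast
    qed
    then show ?thesis by (intro continuous_on_sum continuous_on_divide continuous_on_add continuous_on_const) auto
  qed
  ultimately show ?thesis unfolding code_def by (intro uniform_limit_theorem) auto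
qed

section \<open>Realising every itinerary\<close>

text \<open>Take for \<open>b'\<close> the first time at level \<open>hi\<close> and for
  \<open>a'\<close> the last earlier time at level \<open>lo\<close>; by the intermediate value
  theorem neither level is passed in between.\<close>

lemma subinterval_between_levels_increasing:
  fixes r :: "real \<Rightarrow> real"
  assumes r: "continuous_on {a..b} r" and "a \<le> b" "r a \<le> lo" "lo \<le> hi" "hi \<le> r b"
  obtains a' b' where "a \<le> a'" "a' \<le> b'" "b' \<le> b" "r a' = lo" "r b' = hi"
    "\<And>t. t \<in> {a'..b'} \<Longrightarrow> r t \<in> {lo..hi}"
proof -
  let ?S = "{a..b} \<inter> r -` {hi}"
  have "?S \<noteq> {}" using IVT'[of r a hi b] assms by auto
  moreover have "compact ?S"
    using continuous_closed_preimage[OF r, of "{hi}"] by (auto simp: compact_eq_bounded_closed intro: bounded_Int)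
  ultimately obtain b' where b': "b' \<in> ?S" "\<forall>t\<in>?S. b' \<le> t"
    using compact_attains_inf[of ?S] by metis
  have rb: "continuous_on {a..b'} r" using b' by (intro continuous_on_subset[OF r]) auto
  have up: "r t \<le> hi" if t: "t \<in> {a..b'}" for t
  proof (rule ccontr)
    assume "\<not> r t \<le> hi"
    then obtain u where u: "a \<le> u" "u \<le> t" "r u = hi"
      using IVT'[of r a hi t] assms t continuous_on_subset[OF rb, of "{a..t}"] by auto
    then have "b' \<le> u" using b' t by auto
    then have "u = t" using u t by auto
    then show False using u \<open>\<not> r t \<le> hi\<close> by simp
  qed
  let ?T = "{a..b'} \<inter> r -` {lo}"
  have "?T \<noteq> {}" using IVT'[of r a lo b'] assms b' rb by auto
  moreover have "compact ?T"
    using continuous_closed_preimage[OF rb, of "{lo}"] by (auto simp: compact_eq_bounded_closed intro: bounded_Int)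
  ultimately obtain a' where a': "a' \<in> ?T" "\<forall>t\<in>?T. t \<le> a'"
    using compact_attains_sup[of ?T] by metis
  have low: "lo \<le> r t" if t: "t \<in> {a'..b'}" for t
  proof (rule ccontr)
    assume n: "\<not> lo \<le> r t"
    then obtain u where u: "t \<le> u" "u \<le> b'" "r u = lo"
      using IVT'[of r t lo b'] assms t a' b' continuous_on_subset[OF rb, of "{t..b'}"] by auto
    then have "u \<le> a'" using a' t by auto
    then have "u = t" using u t by auto
    then show False using u n by simp
  qed
  show thesis
    by (rule that[of a' b']) (use a' b' low up in auto)
qed

lemma subinterval_between_levels:
  fixes r :: "real \<Rightarrow> real"
  assumes r: "continuous_on {a..b} r" and ab: "a \<le> b" and lh: "lo \<le> hi"
    and ends: "r a \<le> lo \<and> hi \<le> r b \<or> r b \<le> lo \<and> hi \<le> r a"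
  obtains a' b' where "a \<le> a'" "a' \<le> b'" "b' \<le> b" "r a' = lo \<and> r b' = hi \<or> r a' = hi \<and> r b' = lo"
    "\<And>t. t \<in> {a'..b'} \<Longrightarrow> r t \<in> {lo..hi}"
  using ends
proof
  assume "r a \<le> lo \<and> hi \<le> r b"
  then show thesis
    using subinterval_between_levels_increasing[OF r ab _ lh] that by metis
next
  assume *: "r b \<le> lo \<and> hi \<le> r a"
  have "continuous_on {a..b} (\<lambda>t. - r t)" using r by (intro continuous_intros)
  from subinterval_between_levels_increasing[OF this ab, of "- hi" "- lo"] * lh
  obtain a' b' where "a \<le> a'" "a' \<le> b'" "b' \<le> b" "r a' = hi" "r b' = lo"
    "\<And>t. t \<in> {a'..b'} \<Longrightarrow> - r t \<in> {-hi..-lo}"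
    by auto
  then show thesis by (intro that[of a' b']) auto
qed

section \<open>Paths crossing a component of the sector\<close>

text \<open>For \<open>e = 1\<close> and \<open>e = -1\<close> these are the two components of the
  sector with \<open>h > 0\<close>, cut to \<open>cell\<close>.\<close>

definition wedge :: "real \<Rightarrow> (real \<times> real) set" where
  "wedge e = {z \<in> cell. 0 < snd z \<and> snd z \<le> 3 * (e * fst z) \<and> e * fst z \<le> snd z}"

text \<open>The path joins the inner edge \<open>h = 3 * e * a\<close> to the outer edge
  \<open>e * a = h\<close>, in either direction.\<close>

definition crosses :: "real \<Rightarrow> (real \<Rightarrow> real \<times> real) \<Rightarrow> real \<Rightarrow> real \<Rightarrow> bool" where
  "crosses e f a b \<longleftrightarrow> a \<le> b \<and> continuous_on {a..b} f \<and> f ` {a..b} \<subseteq> wedge e \<and>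
     (snd (f a) = 3 * (e * fst (f a)) \<and> e * fst (f b) = snd (f b) \<or>
      snd (f b) = 3 * (e * fst (f b)) \<and> e * fst (f a) = snd (f a))"

lemma wedge_sector: "e \<in> {1, -1} \<Longrightarrow> wedge e \<subseteq> sector"
  by (auto simp: wedge_def sector_def)

lemma sgn_wedge: "e \<in> {1, -1} \<Longrightarrow> z \<in> wedge e \<Longrightarrow> sgn (fst z) = e"
  by (auto simp: wedge_def sgn_if)

text \<open>The inner edge is thrown to the other side, beyond the outer edge of the opposite wedge.
  Together with \<open>wedge_outer\<close> this forces the image of a crossing path through both
  wedges.\<close>

lemma wedge_inner:
  assumes e: "e \<in> {1, -1}" and z: "z \<in> wedge e" "snd z = 3 * (e * fst z)"
  shows "e * fst (G z) < - snd (G z)"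
proof -
  obtain a h where z': "z = (a, h)" by force
  have nz: "a \<noteq> 0" "h \<noteq> 0" "3 * \<bar>a\<bar> \<le> \<bar>h\<bar>" "z \<in> cell" "sgn a = e" "0 < h"
    using e z sgn_wedge[OF e z(1)] by (auto simp: wedge_def z')
  have "2 * \<bar>a\<bar> < hyp a h" "0 < excess (G z)" using excess_inner[of z] nz by (auto simp: z')
  moreover have "e * fst (G z) = 2 * \<bar>a\<bar> - hyp a h" using nz e by (auto simp: G_def z')
  moreover have "0 < snd (G z)" using snd_G_pos nz by (simp add: z')
  ultimately show ?thesis using nz by (simp add: excess_def z' abs_fst_G)
qed

lemma wedge_outer:
  assumes e: "e \<in> {1, -1}" and z: "z \<in> wedge e" "e * fst z = snd z"
  shows "snd (G z) < e * fst (G z)"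
proof -
  obtain a h where z': "z = (a, h)" by force
  have nz: "a \<noteq> 0" "h \<noteq> 0" "\<bar>h\<bar> \<le> \<bar>a\<bar>" "z \<in> cell" "sgn a = e" "0 < h"
    using e z sgn_wedge[OF e z(1)] by (auto simp: wedge_def z')
  have "hyp a h < 2 * \<bar>a\<bar>" "0 < excess (G z)" using excess_outer[of z] nz by (auto simp: z')
  moreover have "e * fst (G z) = 2 * \<bar>a\<bar> - hyp a h" using nz e by (auto simp: G_def z')
  moreover have "0 < snd (G z)" using snd_G_pos nz by (simp add: z')
  ultimately show ?thesis using nz by (simp add: excess_def z' abs_fst_G)
qed

text \<open>The ratio of the coordinates of the image runs between values at most -1 and at least 1,
  hence through \<open>[1/3, 1]\<close> for either choice of sign \<open>e'\<close>.\<close>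

lemma crosses_step:
  assumes e: "e \<in> {1, -1}" "e' \<in> {1, -1}" and c: "crosses e f a b"
  obtains a' b' where "a \<le> a'" "b' \<le> b" "crosses e' (G \<circ> f) a' b'"
proof -
  have ab: "a \<le> b" and w: "\<And>t. t \<in> {a..b} \<Longrightarrow> f t \<in> wedge e"
    using c by (auto simp: crosses_def)
  have cont: "continuous_on {a..b} (G \<circ> f)"
    using c wedge_sector[OF e(1)]
    by (intro continuous_on_compose continuous_on_subset[OF continuous_on_G]) (auto simp: crosses_def)
  have pos: "0 < snd (G (f t))" if "t \<in> {a..b}" for t
    using w[OF that] e by (intro snd_G_pos) (auto simp: wedge_def)
  have gcell: "G (f t) \<in> cell" if "t \<in> {a..b}" for t
    using w[OF that] by (intro G_cell) (auto simp: wedge_def)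
  \<comment> \<open>On the upper half of \<open>cell\<close>, membership in \<open>wedge e'\<close>
    means that this ratio lies between \<open>1/3\<close> (inner edge) and 1 (outer edge).\<close>
  define r where "r t = e' * fst (G (f t)) / snd (G (f t))" for t
  have "continuous_on {a..b} r" unfolding r_def using cont pos
    by (intro continuous_intros) (auto simp: o_def less_imp_neq[symmetric])
  moreover have "r a \<le> 1/3 \<and> 1 \<le> r b \<or> r b \<le> 1/3 \<and> 1 \<le> r a"
  proof -
    define q where "q t = e * fst (G (f t)) / snd (G (f t))" for t
    have i: "q t \<le> -1" if "t \<in> {a..b}" "snd (f t) = 3 * (e * fst (f t))" for t
      using wedge_inner[OF e(1) w[OF that(1)] that(2)] pos[OF that(1)] by (simp add: divide_le_eq q_def)
    have o: "1 \<le> q t" if "t \<in> {a..b}" "e * fst (f t) = snd (f t)" for t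
      using wedge_outer[OF e(1) w[OF that(1)] that(2)] pos[OF that(1)] by (simp add: le_divide_eq q_def)
    have "a \<in> {a..b}" "b \<in> {a..b}" using ab by auto
    then have q: "q a \<le> -1 \<and> 1 \<le> q b \<or> q b \<le> -1 \<and> 1 \<le> q a"
      using c i o unfolding crosses_def by blast
    have "e' = e \<or> e' = - e" using e by auto
    then show ?thesis
    proof
      assume "e' = e"
      then have "r = q" by (simp add: r_def q_def fun_eq_iff)
      then show ?thesis using q by auto
    next
      assume "e' = - e"
      then have "r t = - q t" for t by (simp add: r_def q_def)
      then show ?thesis using q by auto
    qed
  qed
  ultimately obtain a' b' where ab': "a \<le> a'" "a' \<le> b'" "b' \<le> b"
    and ends: "r a' = 1/3 \<and> r b' = 1 \<or> r a' = 1 \<and> r b' = 1/3"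
    and mid: "\<And>t. t \<in> {a'..b'} \<Longrightarrow> r t \<in> {1/3..1}"
    using subinterval_between_levels[of a b r "1/3" 1] ab by auto
  have "crosses e' (G \<circ> f) a' b'"
    unfolding crosses_def
  proof (intro conjI)
    show "continuous_on {a'..b'} (G \<circ> f)" using ab' by (intro continuous_on_subset[OF cont]) auto
    show "(G \<circ> f) ` {a'..b'} \<subseteq> wedge e'"
    proof (rule image_subsetI)
      fix t assume t: "t \<in> {a'..b'}"
      then have t': "t \<in> {a..b}" using ab' by auto
      show "(G \<circ> f) t \<in> wedge e'"
        using mid[OF t] pos[OF t'] gcell[OF t']
        by (simp add: wedge_def r_def le_divide_eq divide_le_eq)
    qed
    have "snd (G (f t)) = 3 * (e' * fst (G (f t)))" if "r t = 1/3" "t \<in> {a'..b'}" for t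
      using that pos[of t] ab' by (simp add: r_def field_simps)
    moreover have "e' * fst (G (f t)) = snd (G (f t))" if "r t = 1" "t \<in> {a'..b'}" for t
      using that pos[of t] ab' by (simp add: r_def field_simps)
    ultimately show "snd ((G \<circ> f) a') = 3 * (e' * fst ((G \<circ> f) a')) \<and> e' * fst ((G \<circ> f) b') = snd ((G \<circ> f) b') \<or>
      snd ((G \<circ> f) b') = 3 * (e' * fst ((G \<circ> f) b')) \<and> e' * fst ((G \<circ> f) a') = snd ((G \<circ> f) a')"
      using ends ab' by auto
  qed (use ab' in auto)
  then show thesis using that ab' by blast
qed

text \<open>Start with the horizontal segment at height \<open>h\<close> across
  \<open>wedge (s 0)\<close> and shrink its parameter interval by \<open>crosses_step\<close> once
  per sign; a common point of the nested compact intervals has the prescribed signs.\<close>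

lemma ex_trapped_itinerary:
  assumes s: "\<And>k. s k \<in> {1, -1::real}" and h: "0 < h" "h < 1/100"
  obtains z where "z \<in> trapped_up" "snd z = h" "\<And>k. sgn (fst ((G ^^ k) z)) = s k"
proof -
  define f where "f t = (s 0 * (t * h), h)" for t
  have e: "s 0 * (s 0 * x) = x" for x using s[of 0] by auto
  have "crosses (s 0) f (1/3) 1"
    unfolding crosses_def
  proof (intro conjI)
    show "continuous_on {1/3..1} f" unfolding f_def by (intro continuous_intros)
    show "f ` {1/3..1} \<subseteq> wedge (s 0)"
    proof (rule image_subsetI)
      fix t :: real assume t: "t \<in> {1/3..1}"
      have th: "h \<le> 3 * (t * h)" "t * h \<le> h" using t h by auto
      have "\<bar>s 0 * (t * h)\<bar> = t * h" using s[of 0] t h by (auto simp: abs_mult)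
      then show "f t \<in> wedge (s 0)"
        unfolding f_def wedge_def cell_def mem_Collect_eq fst_conv snd_conv e using th h by linarith
    qed
  qed (simp_all add: f_def e)
  note start = this
  let ?P = "\<lambda>n (p :: real \<times> real). crosses (s n) ((G ^^ n) \<circ> f) (fst p) (snd p)"
  let ?Q = "\<lambda>(n :: nat) (p :: real \<times> real) q. fst p \<le> fst q \<and> snd q \<le> snd p"
  have "\<exists>q. ?P (Suc n) q \<and> ?Q n p q" if "?P n p" for n p
  proof -
    obtain a' b' where "fst p \<le> a'" "b' \<le> snd p" "crosses (s (Suc n)) (G \<circ> ((G ^^ n) \<circ> f)) a' b'"
      using crosses_step[OF s s \<open>?P n p\<close>] by metis
    then show ?thesis by (intro exI[of _ "(a', b')"]) (simp add: o_assoc)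
  qed
  moreover have "\<exists>p. ?P 0 p" using start by (intro exI[of _ "(1/3, 1)"]) (simp add: id_def o_def)
  ultimately obtain F where F: "\<And>n. ?P n (F n)" "\<And>n. ?Q n (F n) (F (Suc n))"
    using dependent_nat_choice[of ?P ?Q] by metis
  let ?I = "\<lambda>n. {fst (F n)..snd (F n)}"
  have "\<Inter> (range ?I) \<noteq> {}"
  proof (rule compact_nest)
    show "?I n \<noteq> {}" for n using F(1)[of n] by (simp add: crosses_def)
    show "?I n \<subseteq> ?I m" if "m \<le> n" for m n
      using that by (rule lift_Suc_antimono_le[rotated]) (use F(2) in auto)
  qed simp
  then obtain t where "t \<in> \<Inter> (range ?I)" by blast
  then have t: "t \<in> ?I n" for n by blast
  have w: "(G ^^ n) (f t) \<in> wedge (s n)" for n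
    using F(1)[of n] t[of n] by (auto simp: crosses_def)
  have "f t \<in> cell" using w[of 0] by (simp add: wedge_def)
  moreover have "(G ^^ k) (f t) \<in> sector" for k using w wedge_sector[OF s] by blast
  ultimately have tr: "f t \<in> trapped" by (simp add: trapped_def)
  show thesis
  proof (rule that)
    show "f t \<in> trapped_up" using tr h by (simp add: trapped_up_def f_def)
    show "snd (f t) = h" by (simp add: f_def)
    show "sgn (fst ((G ^^ k) (f t))) = s k" for k using sgn_wedge[OF s w] .
  qed
qed

text \<open>Realise the ternary digits of \<open>c\<close> as signs. Each step scales the difference
  between the code and the expanded \<open>c\<close> by 3 while it stays at most 1, so the initial
  difference is zero.\<close>

lemma code_onto:
  assumes c: "c \<in> cantor_set" and h: "0 < h" "h < 1/100"
  obtains z where "z \<in> trapped_up" "code z = c" "snd z = h"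
proof -
  define cs where "cs k = ((\<lambda>c. if c \<le> 1/2 then 3 * c else 3 * c - 2) ^^ k) c" for k
  define s :: "nat \<Rightarrow> real" where "s k = (if cs k \<le> 1/2 then -1 else 1)" for k
  \<comment> \<open>The digit \<open>1 + s k\<close> is 0 or 2, which merges both branches into one
    formula.\<close>
  have cs_Suc: "cs (Suc k) = 3 * cs k - (1 + s k)" for k by (simp add: cs_def s_def)
  have cs: "cs k \<in> cantor_set" for k
  proof (induction k)
    case 0 show ?case using c by (simp add: cs_def)
  next
    case (Suc k)
    then show ?case using cantor_set_expand[of "cs k"] by (auto simp: cs_def)
  qed
  have "s k \<in> {1, -1}" for k by (simp add: s_def)
  then obtain z where z: "z \<in> trapped_up" "snd z = h" "\<And>k. sgn (fst ((G ^^ k) z)) = s k"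
    using ex_trapped_itinerary[OF _ h] by metis
  have "code ((G ^^ k) z) - cs k = (code ((G ^^ Suc k) z) - cs (Suc k)) / 3" for k
    using code_unfold[of "(G ^^ k) z"] by (simp add: z(3) cs_Suc field_simps)
  then have *: "code z - c = (code ((G ^^ k) z) - cs k) * (1/3) ^ k" for k
    by (induction k) (simp_all add: cs_def)
  have "\<bar>code z - c\<bar> \<le> (1/3) ^ k" for k
  proof -
    have "0 \<le> cs k" "cs k \<le> 1" using cs[of k] cantor_set_subset by auto
    then have "\<bar>code ((G ^^ k) z) - cs k\<bar> \<le> 1" using code_bounds[of "(G ^^ k) z"] by (simp add: abs_le_iff)
    then show ?thesis unfolding *[of k] abs_mult by (simp add: mult_left_le_one_le)
  qed
  then have "\<bar>code z - c\<bar> \<le> 0"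
    by (intro LIMSEQ_le_const[OF LIMSEQ_power_zero[of "1/3::real"]]) auto
  then show thesis using that z by simp
qed

section \<open>The product structure\<close>

definition chart :: "real \<times> real \<Rightarrow> real \<times> real" where
  "chart z = (code z, 100 * snd z)"

lemma chart_image: "chart ` trapped_up = cantor_set \<times> {0<..<1}"
proof
  show "chart ` trapped_up \<subseteq> cantor_set \<times> {0<..<1}"
    using code_cantor by (auto simp: chart_def trapped_up_def trapped_def cell_def)
  show "cantor_set \<times> {0<..<1} \<subseteq> chart ` trapped_up"
  proof safe
    fix c t :: real assume c: "c \<in> cantor_set" and t: "t \<in> {0<..<1}"
    then obtain z where "z \<in> trapped_up" "code z = c" "snd z = t / 100"
      using code_onto[of c "t / 100"] by auto
    then show "(c, t) \<in> chart ` trapped_up" by (auto simp: chart_def intro!: image_eqI[of _ _ z])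
  qed
qed

text \<open>Injectivity of \<open>chart\<close> and the Lipschitz bound for its inverse at once. The
  left side is at most \<open>9 * |dh| + |dc|\<close>, with \<open>dh\<close> and \<open>dc\<close>
  the differences of height and code; the factor 100 in \<open>chart\<close> makes this at most
  \<open>(9/100 + 1)\<close> times the norm on the right.\<close>

lemma norm_le_chart:
  assumes "z1 \<in> trapped_up" "z2 \<in> trapped_up"
  shows "norm (z1 - z2) \<le> 2 * norm (chart z1 - chart z2)"
proof -
  have "norm (z1 - z2) \<le> \<bar>fst z1 - fst z2\<bar> + \<bar>snd z1 - snd z2\<bar>"
    using sqrt_sum_squares_le_sum_abs by (simp add: norm_prod_def)
  moreover have "\<bar>code z1 - code z2\<bar> \<le> norm (chart z1 - chart z2)"
    using norm_fst_le[of "code z1 - code z2"] by (simp add: chart_def)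
  moreover have "100 * \<bar>snd z1 - snd z2\<bar> \<le> norm (chart z1 - chart z2)"
    using norm_snd_le[of "100 * snd z1 - 100 * snd z2" "code z1 - code z2"]
    unfolding chart_def diff_Pair real_norm_def by (smt (verit))
  moreover have "n \<le> 2 * N" if "n \<le> f + s" "c \<le> N" "100 * s \<le> N" "f \<le> 8 * s + c" "0 \<le> s" for n f s c N :: real
    using that by linarith
  ultimately show ?thesis using fst_diff_le[OF assms] abs_ge_zero by blast
qed

lemma inj_on_chart: "inj_on chart trapped_up"
proof (rule inj_onI)
  fix z1 z2 assume "z1 \<in> trapped_up" "z2 \<in> trapped_up" "chart z1 = chart z2"
  then show "z1 = z2" using norm_le_chart[of z1 z2] by simp
qed

lemma norm_inv_chart_le:
  assumes "p \<in> cantor_set \<times> {0<..<1}" "q \<in> cantor_set \<times> {0<..<1}"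
  shows "norm (inv_into trapped_up chart p - inv_into trapped_up chart q) \<le> 2 * norm (p - q)"
  using norm_le_chart[OF inv_into_into inv_into_into, of p chart q chart] assms
  by (simp add: f_inv_into_f flip: chart_image)

lemma trapped_up_homeomorphic: "trapped_up homeomorphic (cantor_set \<times> {0<..<(1::real)})"
proof -
  let ?g = "inv_into trapped_up chart"
  have "2-lipschitz_on (cantor_set \<times> {0<..<1}) ?g"
    using norm_inv_chart_le by (intro lipschitz_onI) (auto simp: dist_norm)
  then have "continuous_on (cantor_set \<times> {0<..<1}) ?g" by (rule lipschitz_on_continuous_on)
  moreover have "continuous_on trapped_up chart"
    unfolding chart_def by (intro continuous_intros continuous_on_code)
  moreover have "?g ` (cantor_set \<times> {0<..<1}) = trapped_up"
    unfolding chart_image[symmetric] using inj_on_chart by (simp add: inv_into_image_cancel)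
  moreover have "?g (chart z) = z" if "z \<in> trapped_up" for z
    using that by (intro inv_into_f_f inj_on_chart)
  moreover have "chart (?g p) = p" if "p \<in> cantor_set \<times> {0<..<1}" for p
    using that unfolding chart_image[symmetric] by (rule f_inv_into_f)
  ultimately have "homeomorphism trapped_up (cantor_set \<times> {0<..<1}) chart ?g"
    unfolding homeomorphism_def using chart_image by blast
  then show ?thesis unfolding homeomorphic_def by blast
qed

section \<open>Measure and closedness of the trapped set\<close>

text \<open>A Lipschitz image of the product of a null set with an interval, within the
  plane.\<close>

lemma negligible_trapped_up: "negligible trapped_up"
proof -
  let ?C = "cantor_set \<times> {0<..<(1::real)}"
  have "cantor_set \<in> null_sets lborel"
    using negligible_cantor_set closed_cantor_set
    by (simp add: negligible_iff_null_sets null_sets_completion_iff borel_closed)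
  then have "cantor_set \<times> {0<..<(1::real)} \<in> null_sets (lborel \<Otimes>\<^sub>M lborel)"
    by (intro lborel.times_in_null_sets1) auto
  then have "negligible ?C"
    by (simp add: lborel_prod negligible_iff_null_sets null_sets_completionI)
  then have "negligible (inv_into trapped_up chart ` ?C)"
  proof (rule negligible_locally_Lipschitz_image[OF order_refl])
    fix p assume "p \<in> ?C"
    then show "\<exists>T B. open T \<and> p \<in> T \<and>
        (\<forall>q\<in>?C \<inter> T. norm (inv_into trapped_up chart q - inv_into trapped_up chart p) \<le> B * norm (q - p))"
      using norm_inv_chart_le by (intro exI[of _ UNIV] exI[of _ 2]) auto
  qed
  then show ?thesis
    unfolding chart_image[symmetric] using inj_on_chart by (simp add: inv_into_image_cancel)
qed

definition reflect :: "real \<times> real \<Rightarrow> real \<times> real" where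
  "reflect z = (fst z, - snd z)"

lemma G_reflect: "G (reflect z) = reflect (G z)"
  by (cases z) (simp add: G_def reflect_def hyp_def)

lemma reflect_trapped: "z \<in> trapped \<Longrightarrow> reflect z \<in> trapped"
proof -
  assume z: "z \<in> trapped"
  have "(G ^^ k) (reflect z) = reflect ((G ^^ k) z)" for k
    by (induction k) (simp_all add: G_reflect)
  then show ?thesis using z by (auto simp: trapped_def cell_def sector_def reflect_def)
qed

text \<open>The lower half is the mirror image of the upper one, and on \<open>h = 0\<close> only
  the origin is trapped.\<close>

lemma negligible_trapped: "negligible trapped"
proof -
  have "negligible (reflect ` trapped_up)"
    by (intro negligible_differentiable_image_negligible[OF order_refl negligible_trapped_up]
        linear_imp_differentiable_on linearI) (auto simp: reflect_def)
  then have "negligible (trapped_up \<union> reflect ` trapped_up \<union> {(0, 0)})"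
    using negligible_trapped_up by simp
  moreover have "trapped \<subseteq> trapped_up \<union> reflect ` trapped_up \<union> {(0, 0)}"
  proof
    fix z assume z: "z \<in> trapped"
    consider "0 < snd z" | "snd z < 0" | "snd z = 0" by linarith
    then show "z \<in> trapped_up \<union> reflect ` trapped_up \<union> {(0, 0)}"
    proof cases
      case 2
      then have "reflect z \<in> trapped_up" using reflect_trapped[OF z] by (simp add: trapped_up_def reflect_def)
      then show ?thesis by (auto simp: reflect_def intro!: image_eqI[of _ _ "reflect z"])
    next
      case 3
      then show ?thesis using sector_fst_eq_0[OF trapped_sector[OF z]] by (cases z) simp
    qed (use z in \<open>simp add: trapped_up_def\<close>)
  qed
  ultimately show ?thesis by (rule negligible_subset)
qed

lemma closedin_trapped: "closedin (top_of_set cell) trapped"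
  unfolding closedin_limpt
proof (intro conjI allI impI)
  show "trapped \<subseteq> cell" using trapped_cell by blast
  fix l assume "l islimpt trapped \<and> l \<in> cell"
  then show "l \<in> trapped"
    unfolding islimpt_sequential using trapped_closed_seq by (metis Diff_iff)
qed

section \<open>Conjugation with Wilkinson's step\<close>

definition param :: "real \<times> real \<Rightarrow> real \<times> real" where
  "param z = (2 * exp (2 * fst z), snd z * exp (- fst z) / sqrt 2)"

definition unparam :: "real \<times> real \<Rightarrow> real \<times> real" where
  "unparam z = (ln (fst z / 2) / 2, sqrt (fst z) * snd z)"

lemma unparam_param: "unparam (param z) = z"
proof -
  have "exp (2 * fst z) = (exp (fst z))\<^sup>2" by (simp add: exp_double)
  then have "sqrt (2 * exp (2 * fst z)) = sqrt 2 * exp (fst z)" by (simp add: real_sqrt_mult)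
  then show ?thesis by (cases z) (simp add: param_def unparam_def exp_minus field_simps)
qed

lemma param_unparam:
  assumes "0 < fst z" shows "param (unparam z) = z"
proof -
  let ?e = "exp (ln (fst z / 2) / 2)"
  have "?e = sqrt (fst z / 2)"
    using assms by (intro real_sqrt_unique[symmetric]) (simp_all flip: exp_double)
  then show ?thesis
    using assms by (cases z) (simp add: param_def unparam_def exp_minus real_sqrt_divide field_simps)
qed

lemma continuous_on_param: "continuous_on S param"
  unfolding param_def by (intro continuous_intros) simp

lemma continuous_on_unparam: "continuous_on {z. 0 < fst z} unparam"
  unfolding unparam_def by (intro continuous_intros) auto

text \<open>In the coordinates \<^const>\<open>param\<close> the two roots \<open>\<omega>\<^sub>\<plusminus>\<close> of
  \<open>r\<^sub>1\<^sup>2 \<omega>\<^sup>2 - (x\<^sup>2 - 4) \<omega> - 4 x\<^sup>2 y\<^sup>2 = 0\<close> are \<open>tanh (a \<plusminus> b)\<close> with \<open>b = hyp a h\<close>.\<close>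
lemma omega_param:
  assumes "param (a, h) = (x, y)"
  shows "omega_plus x y = tanh (a + hyp a h)" "omega_minus x y = tanh (a - hyp a h)"
proof -
  define E A S C D where "E = exp a" and "A = cosh a" and "S = sinh a"
    and "C = cosh (hyp a h)" and "D = sinh (hyp a h)"
  have E: "E = A + S" "0 < E" by (simp_all add: E_def A_def S_def cosh_plus_sinh)
  have AS: "A\<^sup>2 = 1 + S\<^sup>2" and CD: "C\<^sup>2 = 1 + D\<^sup>2" and D: "D\<^sup>2 = S\<^sup>2 + h\<^sup>2"
    by (simp_all add: A_def S_def C_def D_def cosh_square_eq sinh_hyp_sq)
  have pos: "0 < A" "0 < C" "0 \<le> D" by (simp_all add: A_def C_def D_def hyp_nonneg)
  have x: "x = 2 * E\<^sup>2"
    using assms by (auto simp: param_def E_def exp_double)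
  have "y = h / (E * sqrt 2)"
    using assms by (auto simp: param_def E_def exp_minus field_simps)
  then have y: "y\<^sup>2 = h\<^sup>2 / (2 * E\<^sup>2)"
    by (simp add: power_divide power_mult_distrib mult.commute)
  have xy: "x\<^sup>2 * y\<^sup>2 = 2 * E\<^sup>2 * h\<^sup>2"
    using E(2) unfolding x y by (simp add: power2_eq_square)
  have r: "r1sq x y = 8 * E\<^sup>2 * (A\<^sup>2 + D\<^sup>2)"
  proof -
    have "r1sq x y = 4 + (2 * E\<^sup>2)\<^sup>2 + 8 * E\<^sup>2 * h\<^sup>2"
      unfolding r1sq_def using xy by (simp add: x mult.assoc)
    then show ?thesis using AS D E(1) by algebra
  qed
  \<comment> \<open>The two factors of \<open>Delta\<close> are this sum plus and minus
    \<open>4 * x\<close>. As \<open>C^2 - D^2 = 1\<close>, the difference of squares becomes a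
    perfect square.\<close>
  have "Delta x y = (x\<^sup>2 + 4 + 8 * (x\<^sup>2 * y\<^sup>2))\<^sup>2 - 16 * x\<^sup>2"
    unfolding Delta_def by algebra
  also have "x\<^sup>2 + 4 + 8 * (x\<^sup>2 * y\<^sup>2) = 8 * E\<^sup>2 * (C\<^sup>2 + D\<^sup>2)"
    unfolding xy unfolding x using AS CD D E(1) by algebra
  also have "(8 * E\<^sup>2 * (C\<^sup>2 + D\<^sup>2))\<^sup>2 - 16 * x\<^sup>2 = (16 * E\<^sup>2 * C * D)\<^sup>2"
    unfolding x using CD by algebra
  finally have rt: "sqrt (Delta x y) = 16 * E\<^sup>2 * C * D"
    using pos by (simp add: real_sqrt_unique)
  have x4: "x\<^sup>2 - 4 = 16 * E\<^sup>2 * A * S"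
    unfolding x using AS E(1) by algebra
  have AD: "0 < A\<^sup>2 + D\<^sup>2" using pos by (intro add_pos_nonneg) auto
  have "omega_plus x y = (16 * E\<^sup>2 * (A * S + C * D)) / (16 * E\<^sup>2 * (A\<^sup>2 + D\<^sup>2))"
    unfolding omega_plus_def r rt x4 by (simp add: algebra_simps)
  also have "\<dots> = (A * S + C * D) / (A\<^sup>2 + D\<^sup>2)"
    using E(2) by simp
  also have "\<dots> = (S * C + A * D) / (A * C + S * D)"
  proof -
    have "(A * S + C * D) * (A * C + S * D) = (S * C + A * D) * (A\<^sup>2 + D\<^sup>2)"
      using AS CD by algebra
    moreover have "A * C + S * D \<noteq> 0"
      using cosh_real_pos[of "a + hyp a h"] by (simp add: A_def S_def C_def D_def cosh_add)
    ultimately show ?thesis using AD by (metis frac_eq_eq less_irrefl)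
  qed
  finally show "omega_plus x y = tanh (a + hyp a h)"
    by (simp add: tanh_def sinh_add cosh_add A_def S_def C_def D_def)
  have "omega_minus x y = (16 * E\<^sup>2 * (A * S - C * D)) / (16 * E\<^sup>2 * (A\<^sup>2 + D\<^sup>2))"
    unfolding omega_minus_def r rt x4 by (simp add: algebra_simps)
  also have "\<dots> = (A * S - C * D) / (A\<^sup>2 + D\<^sup>2)"
    using E(2) by simp
  also have "\<dots> = (S * C - A * D) / (A * C - S * D)"
  proof -
    have "(A * S - C * D) * (A * C - S * D) = (S * C - A * D) * (A\<^sup>2 + D\<^sup>2)"
      using AS CD by algebra
    moreover have "A * C - S * D \<noteq> 0"
      using cosh_real_pos[of "a - hyp a h"] by (simp add: A_def S_def C_def D_def cosh_diff)
    ultimately show ?thesis using AD by (metis frac_eq_eq less_irrefl)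
  qed
  finally show "omega_minus x y = tanh (a - hyp a h)"
    by (simp add: tanh_def sinh_diff cosh_diff A_def S_def C_def D_def)
qed

text \<open>For \<open>w = tanh c\<close> the two multipliers are \<open>exp (2 * c)\<close> and
  \<open>|sinh c| * exp (- c)\<close>; the first translates \<open>a\<close> by
  \<open>c\<close>.\<close>

lemma W_of_tanh:
  assumes "param (a, h) = (x, y)"
  shows "W_of (tanh c) x y = param (a + c, h * \<bar>sinh c\<bar>)"
proof -
  have c: "0 < cosh c" by simp
  have t: "tanh c = sinh c / cosh c" by (simp add: tanh_def)
  have p: "1 + tanh c = exp c / cosh c" "1 - tanh c = exp (- c) / cosh c"
    using c by (simp_all add: t field_simps cosh_plus_sinh cosh_minus_sinh flip: cosh_plus_sinh cosh_minus_sinh)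
  have "exp (2 * c) = exp c * exp c" by (simp flip: exp_add)
  then have "(1 + tanh c) / (1 - tanh c) = exp (2 * c)"
    using c by (simp add: p exp_minus field_simps)
  moreover have "\<bar>tanh c\<bar> / (1 + tanh c) = \<bar>sinh c\<bar> * exp (- c)"
    using c unfolding p unfolding t by (simp add: exp_minus divide_inverse abs_mult)
  moreover have "exp (2 * (a + c)) = exp (2 * c) * exp (2 * a)" "exp (- (a + c)) = exp (- c) * exp (- a)"
    by (simp_all flip: exp_add)
  ultimately show ?thesis
    using assms by (auto simp: W_of_def param_def)
qed

lemma fst_param: "fst (param z) < 2 \<longleftrightarrow> fst z < 0" "fst (param z) > 2 \<longleftrightarrow> fst z > 0"
    "fst (param z) = 2 \<longleftrightarrow> fst z = 0"
  by (simp_all add: param_def)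

lemma W_param: "W (param z) = param (G z)"
proof -
  obtain a h where z: "z = (a, h)" by force
  obtain x y where xy: "param (a, h) = (x, y)" by force
  consider "a < 0" | "a = 0" | "0 < a" by linarith
  then show ?thesis
  proof cases
    case 1
    then have "W (param z) = W_of (tanh (a + hyp a h)) x y"
      using fst_param(1)[of z] xy by (simp add: z W_def W_plus_def omega_param[OF xy])
    also have "\<dots> = param (a + (a + hyp a h), h * \<bar>sinh (a + hyp a h)\<bar>)" by (rule W_of_tanh[OF xy])
    also have "\<dots> = param (G z)"
      using 1 abs_le_hyp[of a h] by (simp add: G_def z add.commute flip: sinh_real_abs)
    finally show ?thesis .
  next
    case 2
    then show ?thesis by (simp add: W_def z G_def param_def p0_def)
  next
    case 3
    then have "W (param z) = W_of (tanh (a - hyp a h)) x y"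
      using fst_param(2)[of z] xy by (simp add: z W_def W_minus_def omega_param[OF xy])
    also have "\<dots> = param (a + (a - hyp a h), h * \<bar>sinh (a - hyp a h)\<bar>)" by (rule W_of_tanh[OF xy])
    also have "\<dots> = param (G z)"
      using 3 abs_le_hyp[of a h] by (simp add: G_def z flip: sinh_real_abs)
    finally show ?thesis .
  qed
qed

lemma W_iter_param: "(W ^^ k) (param z) = param ((G ^^ k) z)"
  by (induction k) (simp_all add: W_param)

lemma param_zero: "param (0, 0) = p0"
  by (simp add: param_def p0_def)

section \<open>The neighbourhood and the estimates in the original coordinates\<close>

lemma exp_bounds:
  fixes a :: real
  assumes "\<bar>a\<bar> < 1/50"
  shows "1/2 \<le> exp a" "exp a \<le> 3/2"
proof -
  show "1/2 \<le> exp a" using exp_ge_add_one_self[of a] assms by linarith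
  have "exp a \<le> exp (1/50)" using assms by simp
  also have "\<dots> \<le> 1 + 1/50 + (1/50)\<^sup>2" by (rule exp_bound) auto
  finally show "exp a \<le> 3/2" by (simp add: power2_eq_square)
qed

text \<open>With \<open>q = exp (2 * a)\<close> the expression defining \<open>Rset\<close> becomes
  \<open>4 - 2 * h^2 / q - 2 * q * h^2 - 8 * h^4\<close>.\<close>

lemma param_Rset:
  assumes "z \<in> cell" shows "param z \<in> Rset"
proof -
  obtain a h where z: "z = (a, h)" by force
  have a: "\<bar>2 * a\<bar> < 1/50" and h: "\<bar>h\<bar> < 1/100" using assms by (auto simp: z cell_def)
  define q where "q = exp (2 * a)"
  have q: "1/2 \<le> q" "q \<le> 3/2" unfolding q_def by (rule exp_bounds[OF a])+
  obtain x y where xy: "param z = (x, y)" by force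
  then have x: "x = 2 * q" and y: "y = h * exp (- a) / sqrt 2" by (auto simp: param_def z q_def)
  have "(exp (- a))\<^sup>2 = exp (- (2 * a))" by (simp flip: exp_double)
  then have "(exp (- a))\<^sup>2 = 1 / q" by (simp add: q_def exp_minus inverse_eq_divide)
  then have y2: "y\<^sup>2 = h\<^sup>2 / (2 * q)" by (simp add: y power_divide power_mult_distrib)
  have h2: "h\<^sup>2 \<le> 1/100" using h abs_le_square_iff[of h "1/10"] by (auto simp: power2_eq_square)
  have y4: "y ^ 4 = (h\<^sup>2)\<^sup>2 / (4 * q\<^sup>2)"
    using y2 power_mult[of y 2 2] by (simp add: power_divide power_mult_distrib)
  have "4 * y\<^sup>2 \<le> 4 * (1/100)"
    using q h2 unfolding y2 by (intro mult_left_mono) (auto simp: divide_le_eq)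
  moreover have "x\<^sup>2 * y\<^sup>2 = 2 * (q * h\<^sup>2)"
    using q unfolding x y2 by (simp add: power2_eq_square)
  moreover have "q * h\<^sup>2 \<le> 3/2 * (1/100)" using q h2 by (intro mult_mono) auto
  moreover have "8 * x\<^sup>2 * y ^ 4 = 8 * (h\<^sup>2)\<^sup>2"
    using q unfolding x y4 by (simp add: power2_eq_square)
  moreover have "(h\<^sup>2)\<^sup>2 \<le> (1/10)\<^sup>2" using h2 by (intro power_mono) auto
  then have "(h\<^sup>2)\<^sup>2 \<le> 1/100" by (simp add: power2_eq_square)
  ultimately have "0 \<le> 4 - 4 * y\<^sup>2 - x\<^sup>2 * y\<^sup>2 - 8 * x\<^sup>2 * y ^ 4" by linarith
  then show ?thesis using q by (simp add: xy Rset_def x)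
qed

lemma param_Wdom:
  assumes "z \<in> cell"
  shows "param z \<in> Wdom \<longleftrightarrow> (fst z = 0 \<longrightarrow> z = (0, 0))"
proof -
  have "param z = p0 \<longleftrightarrow> z = (0, 0)" by (metis param_zero unparam_param)
  then show ?thesis using param_Rset[OF assms] fst_param(3)[of z] by (simp add: Wdom_def)
qed

lemma orbit_defined_param:
  assumes "z \<in> cell"
  shows "orbit_defined (param z) \<longleftrightarrow> (\<forall>k. fst ((G ^^ k) z) = 0 \<longrightarrow> (G ^^ k) z = (0, 0))"
  using param_Wdom[OF G_iter_cell[OF assms]] by (simp add: orbit_defined_def W_iter_param)

lemma tendsto_param:
  "(\<lambda>k. param (f k)) \<longlonglongrightarrow> p0 \<longleftrightarrow> f \<longlonglongrightarrow> (0, 0)"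
proof
  assume "(\<lambda>k. param (f k)) \<longlonglongrightarrow> p0"
  then have "(\<lambda>k. unparam (param (f k))) \<longlonglongrightarrow> unparam p0"
    by (rule continuous_on_tendsto_compose[OF continuous_on_unparam]) (auto simp: p0_def param_def)
  then show "f \<longlonglongrightarrow> (0, 0)" by (simp add: unparam_param flip: param_zero)
next
  assume "f \<longlonglongrightarrow> (0, 0)"
  then show "(\<lambda>k. param (f k)) \<longlonglongrightarrow> p0"
    unfolding param_zero[symmetric]
    by (rule continuous_on_tendsto_compose[OF continuous_on_param[of UNIV]]) auto
qed

lemma trapped_iff:
  assumes "z \<in> cell"
  shows "orbit_defined (param z) \<and> (\<lambda>k. (W ^^ k) (param z)) \<longlonglongrightarrow> p0 \<longleftrightarrow> z \<in> trapped"
proof -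
  have "(G ^^ k) z = (0, 0)" if "z \<in> trapped" "fst ((G ^^ k) z) = 0" for k
    using sector_fst_eq_0[OF trapped_sector[OF G_iter_trapped[OF that(1), of k]]] that(2)
    by (simp add: prod_eq_iff)
  then show ?thesis
    unfolding orbit_defined_param[OF assms] W_iter_param tendsto_param
    using tendsto_imp_trapped[OF assms] trapped_tendsto[of z] by blast
qed

text \<open>The bounds for \<open>h\<close> carry over because the exponential factors lie between
  \<open>1/2\<close> and \<open>3/2\<close>; the constant 32 absorbs them and the factor
  \<open>sqrt 2\<close>.\<close>

lemma quadratic_param:
  assumes "z \<in> trapped"
  shows "1/32 * \<bar>snd (param z)\<bar>\<^sup>2 \<le> \<bar>snd (param (G z))\<bar>"
    and "\<bar>snd (param (G z))\<bar> \<le> 32 * \<bar>snd (param z)\<bar>\<^sup>2"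
proof -
  note z = trapped_cell[OF assms] trapped_sector[OF assms]
  define e e' where "e = exp (- fst z)" and "e' = exp (- fst (G z))"
  have e: "1/2 \<le> e" "e \<le> 3/2" "1/2 \<le> e'" "e' \<le> 3/2"
    unfolding e_def e'_def using z(1) G_cell[OF z(1)] by (intro exp_bounds; simp add: cell_def)+
  define h h' where "h = \<bar>snd z\<bar>" and "h' = \<bar>snd (G z)\<bar>"
  have h: "h\<^sup>2 / 4 \<le> h'" "h' \<le> 2 * h\<^sup>2" "0 \<le> h'"
    using snd_G_ge[OF z] snd_G_le[OF z(1)] by (simp_all add: h_def h'_def)
  have y: "\<bar>snd (param z)\<bar>\<^sup>2 = h\<^sup>2 * e\<^sup>2 / 2" and y': "\<bar>snd (param (G z))\<bar> = h' * e' / sqrt 2"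
    by (simp_all add: param_def h_def h'_def e_def e'_def abs_mult power_divide power_mult_distrib)
  have s: "1 \<le> sqrt 2" "sqrt 2 \<le> 2" by (auto intro: real_le_lsqrt)
  have "(1/2)\<^sup>2 \<le> e\<^sup>2" "e\<^sup>2 \<le> (3/2)\<^sup>2" using e by (auto intro!: power_mono)
  then have e2: "1/4 \<le> e\<^sup>2" "e\<^sup>2 \<le> 4" by (simp_all add: power2_eq_square)
  have "1/32 * (h\<^sup>2 * e\<^sup>2 / 2) \<le> 1/32 * (h\<^sup>2 * 4 / 2)"
    using e2 by (intro mult_left_mono divide_right_mono) auto
  also have "\<dots> \<le> h' * (1/2) / 2" using h by simp
  also have "\<dots> \<le> h' * e' / sqrt 2"
    using h e s by (intro frac_le mult_left_mono mult_nonneg_nonneg) auto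
  finally show "1/32 * \<bar>snd (param z)\<bar>\<^sup>2 \<le> \<bar>snd (param (G z))\<bar>" unfolding y y' .
  have "h' * e' / sqrt 2 \<le> (2 * h\<^sup>2) * (3/2) / 1"
    using h e s by (intro frac_le mult_mono) auto
  also have "\<dots> \<le> 32 * (h\<^sup>2 * (1/4) / 2)" by simp
  also have "\<dots> \<le> 32 * (h\<^sup>2 * e\<^sup>2 / 2)"
    using e2 by (intro mult_left_mono divide_right_mono) auto
  finally show "\<bar>snd (param (G z))\<bar> \<le> 32 * \<bar>snd (param z)\<bar>\<^sup>2" unfolding y y' .
qed

lemma has_derivative_param:
  "(param has_derivative (\<lambda>v. (4 * exp (2 * fst z) * fst v, (snd v - snd z * fst v) * exp (- fst z) / sqrt 2)))
     (at z within S)"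
proof -
  have "((\<lambda>z. (2 * exp (2 * fst z), snd z * exp (- fst z) / c)) has_derivative
      (\<lambda>v. (4 * exp (2 * fst z) * fst v, (snd v - snd z * fst v) * exp (- fst z) / c))) (at z within S)"
    if "c \<noteq> 0" for c
    using that
    by (auto intro!: derivative_eq_intros simp: algebra_simps diff_divide_distrib)
  from this[of "sqrt 2"] show ?thesis unfolding param_def by simp
qed

theorem theorem5p1:
  "\<exists>A. open A \<and> p0 \<in> A \<and> A \<subseteq> Rset \<and>
     (let X = {z0 \<in> A. orbit_defined z0 \<and> (\<lambda>k. (W ^^ k) z0) \<longlonglongrightarrow> p0} in
        closedin (top_of_set A) X \<and>
        X \<in> null_sets lborel \<and>
        W ` X \<subseteq> X \<and>
        (\<forall>z0 \<in> X. snd z0 \<noteq> 0 \<longrightarrow>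
           (\<exists>c C. c > 0 \<and> C > 0 \<and>
              (\<forall>k. c * \<bar>snd ((W ^^ k) z0)\<bar>^2 \<le> \<bar>snd ((W ^^ Suc k) z0)\<bar> \<and>
                   \<bar>snd ((W ^^ Suc k) z0)\<bar> \<le> C * \<bar>snd ((W ^^ k) z0)\<bar>^2))) \<and>
        (X \<inter> {z. snd z > 0}) homeomorphic (cantor_set \<times> {0<..<(1::real)}))"
proof -
  \<comment> \<open>The preimage form makes \<open>A\<close> open; as the image of
    \<open>cell\<close> it inherits the dynamics of \<open>G\<close>.\<close>
  define A where "A = {z. 0 < fst z} \<inter> unparam -` cell"
  define X where "X = {z0 \<in> A. orbit_defined z0 \<and> (\<lambda>k. (W ^^ k) z0) \<longlonglongrightarrow> p0}"
  have fst_pos: "0 < fst (param z)" for z by (simp add: param_def)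
  have A: "A = param ` cell"
  proof
    show "A \<subseteq> param ` cell"
    proof
      fix z assume "z \<in> A"
      then show "z \<in> param ` cell" using param_unparam[of z] by (intro image_eqI[of _ _ "unparam z"]) (auto simp: A_def)
    qed
    show "param ` cell \<subseteq> A" using fst_pos by (auto simp: A_def unparam_param)
  qed
  have X: "X = param ` trapped"
  proof
    show "X \<subseteq> param ` trapped" unfolding X_def A using trapped_iff by blast
    show "param ` trapped \<subseteq> X"
    proof (rule image_subsetI)
      fix z assume "z \<in> trapped"
      then show "param z \<in> X" using trapped_cell trapped_iff[of z] by (simp add: X_def A)
    qed
  qed
  have "open cell" unfolding cell_def by (intro open_Collect_conj open_Collect_less continuous_intros)
  then have "open A"
    unfolding A_def by (intro continuous_open_preimage[OF continuous_on_unparam] open_Collect_less continuous_intros)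
  moreover have "p0 \<in> A" unfolding A by (rule image_eqI[of _ _ "(0, 0)"]) (simp_all add: param_zero cell_def)
  moreover have "A \<subseteq> Rset" unfolding A using param_Rset by auto
  moreover have closed: "closedin (top_of_set A) X"
  proof -
    have "closedin (top_of_set A) (A \<inter> unparam -` trapped)"
    proof (rule continuous_closedin_preimage_gen[OF _ _ closedin_trapped])
      show "continuous_on A unparam" by (rule continuous_on_subset[OF continuous_on_unparam]) (simp add: A_def)
    qed (auto simp: A_def)
    moreover have "A \<inter> unparam -` trapped = X"
      unfolding X A using trapped_cell by (auto simp: unparam_param)
    ultimately show ?thesis by simp
  qed
  moreover have "X \<in> null_sets lborel"
  proof -
    \<comment> \<open>Membership in \<open>null_sets lborel\<close> demands a Borel set, beyond
      negligibility; \<open>X\<close> is relatively closed in an open set.\<close>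
    have "X \<in> sets borel" using closed \<open>open A\<close> by (auto simp: closedin_closed)
    moreover have "param differentiable_on trapped"
      unfolding differentiable_on_def differentiable_def using has_derivative_param by blast
    then have "negligible X" unfolding X
      by (rule negligible_differentiable_image_negligible[OF order_refl negligible_trapped])
    ultimately show ?thesis by (simp add: negligible_iff_null_sets null_sets_completion_iff)
  qed
  moreover have "W ` X \<subseteq> X" unfolding X using W_param G_trapped by auto
  moreover have "\<exists>c C. c > 0 \<and> C > 0 \<and>
      (\<forall>k. c * \<bar>snd ((W ^^ k) z0)\<bar>^2 \<le> \<bar>snd ((W ^^ Suc k) z0)\<bar> \<and>
           \<bar>snd ((W ^^ Suc k) z0)\<bar> \<le> C * \<bar>snd ((W ^^ k) z0)\<bar>^2)" if "z0 \<in> X" for z0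
  proof -
    obtain w where w: "w \<in> trapped" "z0 = param w" using \<open>z0 \<in> X\<close> unfolding X by blast
    show ?thesis
      using quadratic_param[OF G_iter_trapped[OF w(1)]]
      unfolding w(2) W_iter_param by (intro exI[of _ "1/32"] exI[of _ 32]) simp
  qed
  moreover have "(X \<inter> {z. snd z > 0}) homeomorphic (cantor_set \<times> {0<..<(1::real)})"
  proof -
    have "X \<inter> {z. snd z > 0} = param ` trapped_up"
    proof -
      have "0 < snd (param z) \<longleftrightarrow> 0 < snd z" for z by (simp add: param_def zero_less_mult_iff zero_less_divide_iff)
      then show ?thesis unfolding X trapped_up_def by blast
    qed
    moreover have "homeomorphism trapped_up (param ` trapped_up) param unparam"
    proof (rule homeomorphismI)
      show "continuous_on (param ` trapped_up) unparam"
        using fst_pos by (intro continuous_on_subset[OF continuous_on_unparam]) auto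
    qed (use continuous_on_param in \<open>auto simp: unparam_param\<close>)
    then have "trapped_up homeomorphic param ` trapped_up"
      unfolding homeomorphic_def by blast
    then have "param ` trapped_up homeomorphic trapped_up"
      by (rule homeomorphic_sym[THEN iffD1])
    ultimately show ?thesis
      using homeomorphic_trans[OF _ trapped_up_homeomorphic] by simp
  qed
  ultimately show ?thesis
    by (intro exI[of _ A]) (simp add: Let_def flip: X_def)
qed

end
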